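(* Let $\beta$ be a simple root corresponding to a branch vertex of the Dynkin diagram of a (simple, finite) root system of type $X_n$. If $g(x)$ is the Coxeter polynomial of the root system obtained by removing $\beta$ (i.e. the root system whose Dynkin diagram is obtained by deleting the vertex of $\beta$ and its incident edges), then $(x-1)^2g(x)$ is a Coxeter polynomial of $X_n^{(1)}$.
   Context: Let $\alpha_1,\dots,\alpha_n$ be the simple roots of $X_n$, with Weyl-invariant inner product $(\cdot,\cdot)$ and Cartan matrix $C_{i,j}=2(\alpha_i,\alpha_j)/(\alpha_j,\alpha_j)$. Branch vertices. The vertices of the Dynkin diagram are $r_1,\dots,r_n$, with $r_i$ corresponding to $\alpha_i$; $r_i,r_j$ ($i\ne j$) are neighbours if $C_{i,j}\neq0$. Define $b(r_i)=1-\sum_{j\neq i}C_{i,j}$ if $r_i$ has exactly one neighbour, and $b(r_i)=-\sum_{j\ne i}C_{i,j}$ otherwise (sums over $1\le j\le n$). A vertex is a branch vertex if $b$ attains its maximum value on it. (In particular, for type $A_n$ every vertex is a branch vertex.) Coxeter polynomials. For a Cartan matrix (finite or affine) $C$ indexed by a finite set $J$, let $V$ be the real vector space with basis $\{\alpha_i\}_{i\in J}$ and define $\sigma_j(\alpha_i)=\alpha_i-C_{i,j}\alpha_j$. A Coxeter polynomial is the characteristic polynomial on $V$ of a product of all the $\sigma_j$, $j\in J$, each occurring exactly once, in some order. When the Dynkin diagram has no cycles (in particular for every finite root system) this polynomial does not depend on the order; for an empty root system it is $1$. Affine type. The affine Cartan matrix of $X_n^{(1)}$ is $C=(C_{i,j})_{0\le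 i,j\le n}$ with $C_{i,j}=2(\alpha_i,\alpha_j)/(\alpha_j,\alpha_j)$, where $\alpha_0$ is minus the highest root of $X_n$; in this affine case $V$ has dimension $n+1$ with formal basis $\alpha_0,\dots,\alpha_n$. *)

theory Defs
  imports "HOL-Analysis.Euclidean_Space" "Jordan_Normal_Form.Char_Poly"
begin

text \<open>
  Reduced crystallographic root systems. The ambient Euclidean space carries the Weyl-invariant
  inner product; spanning it is part of the definition, so the rank is its dimension.
\<close>

definition cartan_pairing :: "'a::euclidean_space \<Rightarrow> 'a \<Rightarrow> real" where
  "cartan_pairing x y = 2 * inner x y / inner y y"

definition root_system :: "'a::euclidean_space set \<Rightarrow> bool" where
  "root_system R \<longleftrightarrow>
     finite R \<and> 0 \<notin> R \<and> span R = UNIV \<and>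
     (\<forall>a\<in>R. \<forall>b\<in>R. b - cartan_pairing b a *\<^sub>R a \<in> R) \<and>
     (\<forall>a\<in>R. \<forall>b\<in>R. cartan_pairing b a \<in> \<int>) \<and>
     (\<forall>a\<in>R. \<forall>c. c *\<^sub>R a \<in> R \<longrightarrow> c = 1 \<or> c = -1)"

definition simple_root_system :: "'a::euclidean_space set \<Rightarrow> bool" where
  "simple_root_system R \<longleftrightarrow>
     root_system R \<and> R \<noteq> {} \<and>
     \<not> (\<exists>A B. A \<noteq> {} \<and> B \<noteq> {} \<and> A \<union> B = R \<and> A \<inter> B = {} \<and>
              (\<forall>a\<in>A. \<forall>b\<in>B. inner a b = 0))"

definition simple_roots :: "'a::euclidean_space set \<Rightarrow> nat \<Rightarrow> (nat \<Rightarrow> 'a) \<Rightarrow> bool" where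
  "simple_roots R n \<alpha> \<longleftrightarrow>
     inj_on \<alpha> {1..n} \<and> \<alpha> ` {1..n} \<subseteq> R \<and>
     independent (\<alpha> ` {1..n}) \<and> span (\<alpha> ` {1..n}) = UNIV \<and>
     (\<forall>r\<in>R. \<exists>c :: nat \<Rightarrow> int.
        r = (\<Sum>i=1..n. of_int (c i) *\<^sub>R \<alpha> i) \<and>
        ((\<forall>i\<in>{1..n}. 0 \<le> c i) \<or> (\<forall>i\<in>{1..n}. c i \<le> 0)))"

definition highest_root :: "'a::euclidean_space set \<Rightarrow> nat \<Rightarrow> (nat \<Rightarrow> 'a) \<Rightarrow> 'a \<Rightarrow> bool" where
  "highest_root R n \<alpha> \<theta> \<longleftrightarrow>
     \<theta> \<in> R \<and>
     (\<forall>r\<in>R. \<exists>c :: nat \<Rightarrow> nat. \<theta> - r = (\<Sum>i=1..n. of_nat (c i) *\<^sub>R \<alpha> i))"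

definition cartan_matrix :: "(nat \<Rightarrow> 'a::euclidean_space) \<Rightarrow> nat \<Rightarrow> nat \<Rightarrow> real" where
  "cartan_matrix \<alpha> i j = cartan_pairing (\<alpha> i) (\<alpha> j)"

text \<open>
  The roots indexed by \<open>0, \<dots>, n\<close> are linearly dependent; they only serve to define the entries
  of the affine Cartan matrix.
\<close>

definition affine_cartan_matrix ::
  "(nat \<Rightarrow> 'a::euclidean_space) \<Rightarrow> 'a \<Rightarrow> nat \<Rightarrow> nat \<Rightarrow> real" where
  "affine_cartan_matrix \<alpha> \<theta> = cartan_matrix (\<alpha>(0 := - \<theta>))"

definition neighbours :: "(nat \<Rightarrow> nat \<Rightarrow> real) \<Rightarrow> nat set \<Rightarrow> nat \<Rightarrow> nat set" where
  "neighbours C J i = {j \<in> J. j \<noteq> i \<and> C i j \<noteq> 0}"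

definition branch_value :: "(nat \<Rightarrow> nat \<Rightarrow> real) \<Rightarrow> nat set \<Rightarrow> nat \<Rightarrow> real" where
  "branch_value C J i =
     (if card (neighbours C J i) = 1 then 1 - (\<Sum>j\<in>J - {i}. C i j)
      else - (\<Sum>j\<in>J - {i}. C i j))"

definition branch_vertex :: "(nat \<Rightarrow> nat \<Rightarrow> real) \<Rightarrow> nat set \<Rightarrow> nat \<Rightarrow> bool" where
  "branch_vertex C J i \<longleftrightarrow>
     i \<in> J \<and> (\<forall>j\<in>J. branch_value C J j \<le> branch_value C J i)"

text \<open>
  The formal basis of \<open>V\<close> indexed by the finite set \<open>J\<close> is listed in increasing order of the
  indices. With respect to it, \<open>sigma_mat C J j\<close> is the matrix (acting on column vectors) of the
  linear map sending the basis vector of index \<open>i\<close> to itself minus \<open>C i j\<close> times the basis vector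
  of index \<open>j\<close>; so column \<open>q\<close> is the image of the \<open>q\<close>-th basis vector.
\<close>

definition sigma_mat :: "(nat \<Rightarrow> nat \<Rightarrow> real) \<Rightarrow> nat set \<Rightarrow> nat \<Rightarrow> real mat" where
  "sigma_mat C J j =
     (let l = sorted_list_of_set J in
      mat (card J) (card J)
        (\<lambda>(p, q). (if p = q then 1 else 0) - (if l ! p = j then C (l ! q) j else 0)))"

definition coxeter_polynomial ::
  "(nat \<Rightarrow> nat \<Rightarrow> real) \<Rightarrow> nat set \<Rightarrow> real poly \<Rightarrow> bool" where
  "coxeter_polynomial C J f \<longleftrightarrow>
     (\<exists>js. distinct js \<and> set js = J \<and>
        f = char_poly (foldr (\<lambda>j M. sigma_mat C J j * M) js (1\<^sub>m (card J))))"

end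

theory Submission
  imports Defs
begin

text \<open>
  On the ambient space the affine reflection in \<open>\<alpha>\<^sub>0\<close> becomes the reflection in the highest root
  \<open>\<theta>\<close>: the formal space of the affine root system is an extension of the ambient space by the
  null root, which all reflections fix. So an affine Coxeter polynomial is \<open>x - 1\<close> times the
  characteristic polynomial of a product of the simple reflections and \<open>reflect \<theta>\<close> on the ambient
  space, and \<open>(x - 1) g(x)\<close> is the characteristic polynomial there of a product \<open>c'\<close> of all simple
  reflections other than that of \<open>k\<close>. It suffices to order the affine reflections so that the
  first product is conjugate to \<open>c'\<close> (\<open>coxeter_polynomial_affine_if_conjugate\<close>).

  Let \<open>c\<close> be the Coxeter element \<open>reflect (\<alpha> k) \<circ> c'\<close>. If \<open>\<gamma>\<close> is a power of \<open>c\<close> applied to \<open>\<theta>\<close> and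
  \<open>c' \<gamma> = \<alpha> k\<close>, then \<open>c \<circ> reflect \<theta>\<close> is conjugate to \<open>c \<circ> reflect \<gamma> = c'\<close>, and the proof is
  complete. Every orbit of \<open>c\<close> on the roots passes from the positive to the negative roots, since
  \<open>c\<close> has no fixed vector; at this point the orbit of \<open>\<theta>\<close> belongs to some simple root
  \<open>\<alpha> i\<close>, of the same length as \<open>\<theta>\<close> (\<open>coxeter_orbit_representative\<close>). Which \<open>i\<close> occurs is read off
  from the invariant \<open>inner (c \<gamma>) \<gamma> = inner (c \<theta>) \<theta>\<close>: if \<open>\<theta>\<close> is adjacent to a single simple
  root, and by a simple edge, then the weights \<open>C i j * C j i\<close> of the edges at \<open>i\<close> add up to three
  (\<open>weighted_valency_orbit\<close>). Positivity of the inner product, tested on the vector that is \<open>2\<close>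
  at inner vertices and suitably scaled at the leaves, limits the Dynkin diagram to one vertex of
  valency three or one multiple edge (\<open>leaf_inequality\<close>), so that \<open>i\<close> must be the branch vertex
  \<open>k\<close> (\<open>branch_vertex_unique\<close>).

  There remain the diagrams in which \<open>\<theta>\<close> is adjacent to two simple roots or to one by a multiple
  edge, that is, types \<open>A\<close> and \<open>C\<close>. Here the orbit need not belong to \<open>k\<close>, but the branch root is
  long, and reflecting it successively in the other simple roots, moving outwards from \<open>k\<close>,
  produces \<open>\<theta>\<close> itself (\<open>highest_root_as_growing_product\<close>). For this order \<open>c''\<close> of the reflections
  in \<open>c'\<close>, the product \<open>reflect \<theta> \<circ> c'' \<circ> reflect (\<alpha> k)\<close> equals \<open>c''\<close>. As the diagram is a
  forest, all orders give conjugate products (\<open>reorder_all\<close>), so \<open>c''\<close> is conjugate to \<open>c'\<close>.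
\<close>

section \<open>Matrices of linear maps with respect to list bases\<close>

text \<open>The condition is on coordinates, so that bases of the ambient space extended by one coordinate
  can be checked componentwise.\<close>

definition list_basis :: "'v::real_vector list \<Rightarrow> bool" where
  "list_basis bs \<longleftrightarrow>
     (\<forall>x. (\<Sum>p<length bs. x p *\<^sub>R bs ! p) = 0 \<longrightarrow> (\<forall>p<length bs. x p = 0)) \<and>
     (\<forall>v. \<exists>x. v = (\<Sum>p<length bs. x p *\<^sub>R bs ! p))"

definition represents ::
  "'v::real_vector list \<Rightarrow> 'w::real_vector list \<Rightarrow> ('v \<Rightarrow> 'w) \<Rightarrow> real mat \<Rightarrow> bool" where
  "represents bs cs f A \<longleftrightarrow> A \<in> carrier_mat (length cs) (length bs) \<and>
     (\<forall>q<length bs. f (bs ! q) = (\<Sum>p<length cs. A $$ (p, q) *\<^sub>R cs ! p))"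

lemma represents_carrier: "represents bs cs f A \<Longrightarrow> A \<in> carrier_mat (length cs) (length bs)"
  unfolding represents_def by blast

lemma represents_id: "represents bs bs (\<lambda>v. v) (1\<^sub>m (length bs))"
  unfolding represents_def
  by (auto simp: if_distrib[of "\<lambda>c. c *\<^sub>R _"] cong: if_cong)

lemma represents_compose:
  assumes f: "represents bs cs f A" and g: "represents cs ds g B" and lin: "linear g"
  shows "represents bs ds (\<lambda>v. g (f v)) (B * A)"
  unfolding represents_def
proof (intro conjI allI impI)
  have A: "A \<in> carrier_mat (length cs) (length bs)" and B: "B \<in> carrier_mat (length ds) (length cs)"
    using f g by (auto dest: represents_carrier)
  then show "B * A \<in> carrier_mat (length ds) (length bs)" by simp
  fix q assume q: "q < length bs"
  have "g (f (bs ! q)) = (\<Sum>m<length cs. A $$ (m, q) *\<^sub>R g (cs ! m))"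
    using f q unfolding represents_def by (simp add: linear_sum[OF lin] linear_scale[OF lin])
  also have "\<dots> = (\<Sum>m<length cs. \<Sum>p<length ds. (B $$ (p, m) * A $$ (m, q)) *\<^sub>R ds ! p)"
    using g unfolding represents_def by (simp add: scaleR_sum_right mult.commute)
  also have "\<dots> = (\<Sum>p<length ds. \<Sum>m<length cs. (B $$ (p, m) * A $$ (m, q)) *\<^sub>R ds ! p)"
    by (rule sum.swap)
  also have "\<dots> = (\<Sum>p<length ds. (B * A) $$ (p, q) *\<^sub>R ds ! p)"
    using A B q
    by (intro sum.cong) (auto simp: scalar_prod_def scaleR_sum_left atLeast0LessThan)
  finally show "g (f (bs ! q)) = (\<Sum>p<length ds. (B * A) $$ (p, q) *\<^sub>R ds ! p)" .
qed

lemma represents_unique: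
  assumes A: "represents bs cs f A" and B: "represents bs cs f B" and cs: "list_basis cs"
  shows "A = B"
proof (rule eq_matI)
  fix p q assume pq: "p < dim_row B" "q < dim_col B"
  have q: "q < length bs" and p: "p < length cs" using pq represents_carrier[OF B] by auto
  have "(\<Sum>p<length cs. (A $$ (p, q) - B $$ (p, q)) *\<^sub>R cs ! p) = 0"
    using A B q unfolding represents_def
    by (simp add: scaleR_diff_left sum_subtractf)
  then show "A $$ (p, q) = B $$ (p, q)"
    using cs p unfolding list_basis_def by force
qed (use A B in \<open>auto dest!: represents_carrier\<close>)

lemma represents_exists:
  assumes "list_basis cs"
  shows "\<exists>A. represents bs cs f A"
proof -
  have "\<forall>q. \<exists>x. f (bs ! q) = (\<Sum>p<length cs. x p *\<^sub>R cs ! p)"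
    using assms unfolding list_basis_def by blast
  then obtain x where x: "\<And>q. f (bs ! q) = (\<Sum>p<length cs. x q p *\<^sub>R cs ! p)" by metis
  have "represents bs cs f (mat (length cs) (length bs) (\<lambda>(p, q). x q p))"
    unfolding represents_def using x by simp
  then show ?thesis ..
qed

text \<open>The lengths agree by comparing the traces of the two products.\<close>

lemma represents_inverse:
  fixes bs :: "'v::real_vector list" and cs :: "'w::real_vector list"
  assumes bs: "list_basis bs" and cs: "list_basis cs" and "linear u" "linear v"
    and vu: "\<And>x. v (u x) = x" and uv: "\<And>y. u (v y) = y"
    and P: "represents bs cs u P" and Q: "represents cs bs v Q"
  shows "length bs = length cs" "P * Q = 1\<^sub>m (length cs)" "Q * P = 1\<^sub>m (length bs)"
proof -
  have "represents bs bs (\<lambda>x. x) (Q * P)"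
    using represents_compose[OF P Q \<open>linear v\<close>] by (simp add: vu)
  then show QP: "Q * P = 1\<^sub>m (length bs)" using represents_unique[OF _ represents_id bs] by blast
  have "represents cs cs (\<lambda>x. x) (P * Q)"
    using represents_compose[OF Q P \<open>linear u\<close>] by (simp add: uv)
  then show PQ: "P * Q = 1\<^sub>m (length cs)" using represents_unique[OF _ represents_id cs] by blast
  have c: "P \<in> carrier_mat (length cs) (length bs)" "Q \<in> carrier_mat (length bs) (length cs)"
    using P Q by (auto dest: represents_carrier)
  have "real (length bs) = (\<Sum>i<length bs. (Q * P) $$ (i, i))" unfolding QP by simp
  also have "\<dots> = (\<Sum>i<length bs. \<Sum>j<length cs. Q $$ (i, j) * P $$ (j, i))"
    using c by (auto simp: scalar_prod_def atLeast0LessThan intro!: sum.cong)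
  also have "\<dots> = (\<Sum>j<length cs. \<Sum>i<length bs. Q $$ (i, j) * P $$ (j, i))" by (rule sum.swap)
  also have "\<dots> = (\<Sum>j<length cs. (P * Q) $$ (j, j))"
    using c by (auto simp: scalar_prod_def atLeast0LessThan mult.commute intro!: sum.cong)
  also have "\<dots> = real (length cs)" unfolding PQ by simp
  finally show "length bs = length cs" by simp
qed

definition linearly_conjugate :: "('v::real_vector \<Rightarrow> 'v) \<Rightarrow> ('w::real_vector \<Rightarrow> 'w) \<Rightarrow> bool" where
  "linearly_conjugate f g \<longleftrightarrow> (\<exists>u v. linear u \<and> linear v \<and>
     (\<forall>x. v (u x) = x) \<and> (\<forall>y. u (v y) = y) \<and> (\<forall>x. u (f x) = g (u x)))"

lemma linearly_conjugateI:
  assumes "linear u" "linear v" "\<And>x. v (u x) = x" "\<And>y. u (v y) = y" "\<And>x. u (f x) = g (u x)"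
  shows "linearly_conjugate f g"
  unfolding linearly_conjugate_def using assms by blast

lemma linearly_conjugate_refl: "linearly_conjugate f f"
  by (rule linearly_conjugateI[of "\<lambda>x. x" "\<lambda>x. x"]) (auto intro: linear_ident)

lemma linearly_conjugate_trans:
  assumes "linearly_conjugate f g" "linearly_conjugate g h"
  shows "linearly_conjugate f h"
proof -
  obtain u v where uv: "linear u" "linear v" "\<And>x. v (u x) = x" "\<And>y. u (v y) = y"
    "\<And>x. u (f x) = g (u x)" using assms(1) unfolding linearly_conjugate_def by blast
  obtain u' v' where uv': "linear u'" "linear v'" "\<And>x. v' (u' x) = x" "\<And>y. u' (v' y) = y"
    "\<And>x. u' (g x) = h (u' x)" using assms(2) unfolding linearly_conjugate_def by blast
  show ?thesis
    by (rule linearly_conjugateI[of "u' \<circ> u" "v \<circ> v'"])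
       (use uv uv' in \<open>auto intro: linear_compose\<close>)
qed

lemma char_poly_linearly_conjugate:
  assumes conj: "linearly_conjugate f g" and "linear g"
    and bs: "list_basis bs" and cs: "list_basis cs"
    and A: "represents bs bs f A" and B: "represents cs cs g B"
  shows "char_poly A = char_poly B"
proof -
  obtain u v where uv: "linear u" "linear v" "\<And>x. v (u x) = x" "\<And>y. u (v y) = y"
    "\<And>x. u (f x) = g (u x)" using conj unfolding linearly_conjugate_def by blast
  obtain P where P: "represents bs cs u P" using represents_exists[OF cs] by blast
  obtain Q where Q: "represents cs bs v Q" using represents_exists[OF bs] by blast
  note PQ = represents_inverse[OF bs cs uv(1-4) P Q]
  have "represents bs cs (\<lambda>x. u (f x)) (P * A)" by (rule represents_compose[OF A P uv(1)])
  moreover have "represents bs cs (\<lambda>x. u (f x)) (B * P)"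
    unfolding uv(5) by (rule represents_compose[OF P B \<open>linear g\<close>])
  ultimately have eq: "P * A = B * P" by (rule represents_unique[OF _ _ cs])
  define N where "N = length bs"
  have c: "A \<in> carrier_mat N N" "B \<in> carrier_mat N N" "P \<in> carrier_mat N N" "Q \<in> carrier_mat N N"
    using A B P Q PQ(1) unfolding N_def by (auto dest: represents_carrier)
  have "A = (Q * P) * A" using PQ c by (simp add: N_def)
  also have "\<dots> = Q * (B * P)" unfolding eq[symmetric] by (rule assoc_mult_mat) (use c in auto)
  also have "\<dots> = Q * B * P" by (rule assoc_mult_mat[symmetric]) (use c in auto)
  finally have AQ: "A = Q * B * P" .
  have "similar_mat A B"
    by (rule similar_matI[of _ _ Q P N]) (use c PQ AQ in \<open>auto simp: N_def\<close>)
  then show ?thesis by (rule char_poly_similar)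
qed

lemma char_poly_block_triangular:
  fixes B :: "'b::idom mat"
  assumes B: "B \<in> carrier_mat n n" and C: "C \<in> carrier_mat n m" and D: "D \<in> carrier_mat m m"
  shows "char_poly (four_block_mat B C (0\<^sub>m m n) D) = char_poly B * char_poly D"
proof -
  have "char_poly_matrix (four_block_mat B C (0\<^sub>m m n) D)
      = four_block_mat (char_poly_matrix B) (map_mat (\<lambda>a. [:- a:]) C) (0\<^sub>m m n) (char_poly_matrix D)"
    unfolding char_poly_matrix_def
    by (rule eq_matI) (use B C D in \<open>auto simp: one_poly_def\<close>)
  moreover have "det (four_block_mat (char_poly_matrix B) (map_mat (\<lambda>a. [:- a:]) C) (0\<^sub>m m n)
      (char_poly_matrix D)) = det (char_poly_matrix B) * det (char_poly_matrix D)"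
    by (rule det_four_block_mat_lower_left_zero[OF _ _ refl]) (use B C D in auto)
  ultimately show ?thesis unfolding char_poly_def by simp
qed

lemma represents_block_triangular:
  assumes bs: "represents bs bs f B" and D: "D \<in> carrier_mat (length cs) (length cs)"
    and cs: "\<And>q. q < length cs \<Longrightarrow>
      \<exists>x. f (cs ! q) = (\<Sum>p<length bs. x p *\<^sub>R bs ! p) + (\<Sum>p<length cs. D $$ (p, q) *\<^sub>R cs ! p)"
  shows "\<exists>A. represents (bs @ cs) (bs @ cs) f A \<and> char_poly A = char_poly B * char_poly D"
proof -
  obtain x where x: "\<And>q. q < length cs \<Longrightarrow>
      f (cs ! q) = (\<Sum>p<length bs. x q p *\<^sub>R bs ! p) + (\<Sum>p<length cs. D $$ (p, q) *\<^sub>R cs ! p)"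
    using cs by metis
  let ?b = "length bs" and ?c = "length cs"
  define C where "C = mat ?b ?c (\<lambda>(p, q). x q p)"
  define A where "A = four_block_mat B C (0\<^sub>m ?c ?b) D"
  have B: "B \<in> carrier_mat ?b ?b" by (rule represents_carrier[OF bs])
  have split: "(\<Sum>p<?b + ?c. h p *\<^sub>R (bs @ cs) ! p)
      = (\<Sum>p<?b. h p *\<^sub>R bs ! p) + (\<Sum>p<?c. h (?b + p) *\<^sub>R cs ! p)" for h
  proof -
    have "(\<Sum>p<?b + ?c. h p *\<^sub>R (bs @ cs) ! p) = (\<Sum>p<?b. h p *\<^sub>R (bs @ cs) ! p)
        + (\<Sum>p\<in>{?b..<?b + ?c}. h p *\<^sub>R (bs @ cs) ! p)"
      by (subst sum.union_disjoint[symmetric]) (auto intro!: sum.cong)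
    also have "(\<Sum>p\<in>{?b..<?b + ?c}. h p *\<^sub>R (bs @ cs) ! p) = (\<Sum>p<?c. h (?b + p) *\<^sub>R cs ! p)"
      by (rule sum.reindex_bij_witness[of _ "\<lambda>p. ?b + p" "\<lambda>p. p - ?b"]) (auto simp: nth_append)
    finally show ?thesis by (simp add: nth_append)
  qed
  have "represents (bs @ cs) (bs @ cs) f A"
    unfolding represents_def
  proof (intro conjI allI impI)
    show "A \<in> carrier_mat (length (bs @ cs)) (length (bs @ cs))"
      unfolding A_def using B D by simp
    fix q assume q: "q < length (bs @ cs)"
    show "f ((bs @ cs) ! q) = (\<Sum>p<length (bs @ cs). A $$ (p, q) *\<^sub>R (bs @ cs) ! p)"
    proof (cases "q < ?b")
      case True
      then show ?thesis
        using bs B D unfolding represents_def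
        by (simp add: split) (simp add: A_def nth_append)
    next
      case False
      then have "f ((bs @ cs) ! q) = (\<Sum>p<?b. x (q - ?b) p *\<^sub>R bs ! p)
          + (\<Sum>p<?c. D $$ (p, q - ?b) *\<^sub>R cs ! p)"
        using x[of "q - ?b"] q by (simp add: nth_append)
      with False q B D show ?thesis by (simp add: split) (simp add: A_def C_def)
    qed
  qed
  moreover have "char_poly A = char_poly B * char_poly D"
    unfolding A_def by (rule char_poly_block_triangular) (use B D in \<open>auto simp: C_def\<close>)
  ultimately show ?thesis by blast
qed

lemma list_basis_of_independent:
  assumes "distinct bs" "independent (set bs)" "span (set bs) = UNIV"
  shows "list_basis bs"
  unfolding list_basis_def
proof (intro conjI allI impI)
  have reindex: "(\<Sum>p<length bs. x p *\<^sub>R bs ! p) = (\<Sum>b\<in>set bs. x (inv_into {..<length bs} ((!) bs) b) *\<^sub>R b)"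
    for x
    by (subst sum.reindex_bij_betw[OF bij_betw_nth[OF assms(1) refl refl], symmetric])
       (use assms(1) in \<open>auto intro!: sum.cong simp: inj_on_nth\<close>)
  {
    fix x p assume x: "(\<Sum>p<length bs. x p *\<^sub>R bs ! p) = 0" and p: "p < length bs"
    have "(\<Sum>b\<in>set bs. x (inv_into {..<length bs} ((!) bs) b) *\<^sub>R b) = 0"
      using x unfolding reindex .
    then have "x (inv_into {..<length bs} ((!) bs) (bs ! p)) = 0"
      using independentD[OF assms(2) finite_set subset_refl] p by (metis nth_mem)
    then show "x p = 0"
      using p assms(1) by (simp add: inj_on_nth)
  }
  fix v
  have "v \<in> span (set bs)" using assms(3) by simp
  then obtain w where w: "v = (\<Sum>b\<in>set bs. w b *\<^sub>R b)"
    using span_finite[of "set bs"] by auto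
  have "v = (\<Sum>p<length bs. w (bs ! p) *\<^sub>R bs ! p)"
    unfolding w
    by (rule sum.reindex_bij_betw[symmetric]) (use assms(1) in \<open>auto simp: bij_betw_nth\<close>)
  then show "\<exists>x. v = (\<Sum>p<length bs. x p *\<^sub>R bs ! p)"
    by (intro exI[of _ "\<lambda>p. w (bs ! p)"])
qed

text \<open>This serves both the simple roots other than \<open>\<alpha> k\<close>, which span a proper subspace, and the
  formal basis of the affine root system.\<close>

lemma represents_sigma_product:
  fixes b :: "nat \<Rightarrow> 'v::real_vector"
  assumes J: "finite J" and js: "set js \<subseteq> J"
    and lin: "\<And>j. j \<in> J \<Longrightarrow> linear (\<tau> j)"
    and act: "\<And>i j. i \<in> J \<Longrightarrow> j \<in> J \<Longrightarrow> \<tau> j (b i) = b i - C i j *\<^sub>R b j"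
  defines "bs \<equiv> map b (sorted_list_of_set J)"
  shows "represents bs bs (foldr \<tau> js) (foldr (\<lambda>j M. sigma_mat C J j * M) js (1\<^sub>m (card J)))"
  using js
proof (induction js)
  case Nil
  have "length bs = card J" unfolding bs_def by simp
  with represents_id[of bs] show ?case by (simp add: id_def)
next
  case (Cons j js)
  let ?l = "sorted_list_of_set J"
  have jJ: "j \<in> J" using Cons.prems by simp
  have "represents bs bs (\<tau> j) (sigma_mat C J j)"
    unfolding represents_def
  proof (intro conjI allI impI)
    show "sigma_mat C J j \<in> carrier_mat (length bs) (length bs)"
      unfolding bs_def sigma_mat_def Let_def by simp
    fix q assume q: "q < length bs"
    then have q': "q < card J" unfolding bs_def by simp
    obtain r where r: "r < card J" "?l ! r = j"
      using jJ J by (metis in_set_conv_nth length_sorted_list_of_set set_sorted_list_of_set)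
    have only: "?l ! p = j \<longleftrightarrow> p = r" if "p < card J" for p
      using that r distinct_sorted_list_of_set[of J]
      by (metis length_sorted_list_of_set nth_eq_iff_index_eq)
    have "(\<Sum>p<length bs. sigma_mat C J j $$ (p, q) *\<^sub>R bs ! p)
        = (\<Sum>p<card J. (if p = q then bs ! p else 0) - (if p = r then C (?l ! q) j *\<^sub>R bs ! p else 0))"
      using q' unfolding bs_def sigma_mat_def Let_def
      by (intro sum.cong) (auto simp: only scaleR_diff_left)
    also have "\<dots> = bs ! q - C (?l ! q) j *\<^sub>R bs ! r"
      using q' r(1) by (simp add: sum_subtractf)
    also have "\<dots> = \<tau> j (bs ! q)"
    proof -
      have "?l ! q \<in> J" using nth_mem[of q ?l] q' J by simp
      then show ?thesis using q' r act[of "?l ! q" j] jJ unfolding bs_def by simp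
    qed
    finally show "\<tau> j (bs ! q) = (\<Sum>p<length bs. sigma_mat C J j $$ (p, q) *\<^sub>R bs ! p)" ..
  qed
  from represents_compose[OF Cons.IH this lin[OF jJ]] Cons.prems
  show ?case by (simp add: o_def)
qed

section \<open>Products of reflections and Coxeter polynomials\<close>

definition reflect :: "'a::euclidean_space \<Rightarrow> 'a \<Rightarrow> 'a" where
  "reflect a v = v - cartan_pairing v a *\<^sub>R a"

definition reflections :: "(nat \<Rightarrow> 'a::euclidean_space) \<Rightarrow> nat list \<Rightarrow> 'a \<Rightarrow> 'a" where
  "reflections \<beta> js = foldr (\<lambda>j. reflect (\<beta> j)) js"

lemma cartan_pairing_linear: "linear (\<lambda>v. cartan_pairing v a)"
  unfolding cartan_pairing_def
  by (rule linearI) (simp_all add: inner_add_left add_divide_distrib distrib_left)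

lemma linear_reflect: "linear (reflect a)"
  unfolding reflect_def[abs_def] cartan_pairing_def
  by (rule linearI) (simp_all add: inner_add_left add_divide_distrib distrib_left
      scaleR_add_left scaleR_diff_right)

lemma reflect_self: "reflect a a = - a"
  by (cases "a = 0") (simp_all add: reflect_def cartan_pairing_def scaleR_2)

lemma reflect_reflect [simp]: "reflect a (reflect a v) = v"
  by (cases "a = 0")
     (simp_all add: reflect_def cartan_pairing_def inner_diff_left diff_divide_distrib)

lemma inner_reflect [simp]: "inner (reflect a v) (reflect a w) = inner v w"
  by (cases "a = 0")
     (simp_all add: reflect_def cartan_pairing_def inner_diff_left inner_diff_right
       inner_commute field_simps)

lemma reflect_uminus: "reflect (- a) = reflect a"
  by (rule ext) (simp add: reflect_def cartan_pairing_def)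

lemma reflect_isometry:
  assumes "linear u" "\<And>v w. inner (u v) (u w) = inner v w"
  shows "reflect (u a) (u v) = u (reflect a v)"
  unfolding reflect_def cartan_pairing_def
  by (simp add: assms(2) linear_diff[OF assms(1)] linear_scale[OF assms(1)])

lemma reflections_Nil [simp]: "reflections \<beta> [] v = v"
  and reflections_Cons [simp]: "reflections \<beta> (j # js) v = reflect (\<beta> j) (reflections \<beta> js v)"
  and reflections_append [simp]:
    "reflections \<beta> (xs @ ys) v = reflections \<beta> xs (reflections \<beta> ys v)"
  by (simp_all add: reflections_def)

lemma linear_reflections: "linear (reflections \<beta> js)"
proof (induction js)
  case Nil
  show ?case by (simp add: reflections_def id_def linear_ident)
next
  case (Cons j js)
  have "reflections \<beta> (j # js) = reflect (\<beta> j) \<circ> reflections \<beta> js" by (rule ext) simp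
  then show ?case using linear_compose[OF Cons linear_reflect] by metis
qed

lemma inner_reflections [simp]: "inner (reflections \<beta> js v) (reflections \<beta> js w) = inner v w"
  by (induction js) simp_all

lemma reflections_rev_cancel [simp]: "reflections \<beta> (rev js) (reflections \<beta> js v) = v"
  by (induction js arbitrary: v) simp_all

lemma reflections_cancel_rev [simp]: "reflections \<beta> js (reflections \<beta> (rev js) v) = v"
  using reflections_rev_cancel[of \<beta> "rev js"] by simp

lemma inner_reflections_left: "inner (reflections \<beta> js v) w = inner v (reflections \<beta> (rev js) w)"
  using inner_reflections[of \<beta> js v "reflections \<beta> (rev js) w"] by simp

lemma reflections_cong: "(\<And>j. j \<in> set js \<Longrightarrow> \<beta> j = \<gamma> j) \<Longrightarrow> reflections \<beta> js = reflections \<gamma> js"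
  unfolding reflections_def by (induction js) auto

lemma reflections_diff_in_span: "reflections \<beta> js v - v \<in> span (\<beta> ` set js)"
proof (induction js)
  case Nil
  show ?case by (simp add: span_zero)
next
  case (Cons j js)
  have eq: "reflections \<beta> (j # js) v - v = (reflections \<beta> js v - v)
      - cartan_pairing (reflections \<beta> js v) (\<beta> j) *\<^sub>R \<beta> j"
    by (simp add: reflect_def)
  have "reflections \<beta> js v - v \<in> span (\<beta> ` set (j # js))"
    using Cons by (rule subsetD[OF span_mono, rotated]) auto
  moreover have "\<beta> j \<in> span (\<beta> ` set (j # js))" by (simp add: span_base)
  ultimately show ?case unfolding eq by (metis span_diff span_scale)
qed

lemma reflections_fixes:
  assumes "\<And>j. j \<in> set js \<Longrightarrow> inner v (\<beta> j) = 0"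
  shows "reflections \<beta> js v = v"
  using assms by (induction js) (simp_all add: reflect_def cartan_pairing_def)

lemma char_poly_one_1: "char_poly (1\<^sub>m 1 :: real mat) = [:-1, 1:]"
  by (simp add: char_poly_defs det_single)

text \<open>In a basis that ends with \<open>\<alpha> k\<close> the product of the other simple reflections is block
  triangular: it preserves the span of the other simple roots, where its matrix is the given
  product of the \<open>sigma_mat\<close>, and acts as the identity modulo that span.\<close>

lemma char_poly_parabolic:
  fixes \<alpha> :: "nat \<Rightarrow> 'a::euclidean_space"
  assumes inj: "inj_on \<alpha> {1..n}" and ind: "independent (\<alpha> ` {1..n})"
    and span: "span (\<alpha> ` {1..n}) = UNIV" and k: "k \<in> {1..n}" and js: "set js = {1..n} - {k}"
    and bs: "list_basis bs" and A: "represents bs bs (reflections \<alpha> js) A"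
  shows "char_poly A = [:-1, 1:] *
    char_poly (foldr (\<lambda>j M. sigma_mat (cartan_matrix \<alpha>) ({1..n} - {k}) j * M) js
      (1\<^sub>m (card ({1..n} - {k}))))"
proof -
  let ?J = "{1..n} - {k}"
  let ?B = "foldr (\<lambda>j M. sigma_mat (cartan_matrix \<alpha>) ?J j * M) js (1\<^sub>m (card ?J))"
  define l where "l = sorted_list_of_set ?J"
  have l: "distinct l" "set l = ?J" unfolding l_def by auto
  have set_l: "set (l @ [k]) = {1..n}" using k by (simp add: l(2) insert_absorb)
  have cs: "list_basis (map \<alpha> l @ [\<alpha> k])"
  proof (rule list_basis_of_independent)
    show "distinct (map \<alpha> l @ [\<alpha> k])"
    proof -
      have "distinct (l @ [k])" using l by simp
      moreover have "inj_on \<alpha> (set (l @ [k]))" unfolding set_l by (rule inj)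
      ultimately have "distinct (map \<alpha> (l @ [k]))" unfolding distinct_map by blast
      then show ?thesis by simp
    qed
    have "set (map \<alpha> l @ [\<alpha> k]) = \<alpha> ` set (l @ [k])" by simp
    then have "set (map \<alpha> l @ [\<alpha> k]) = \<alpha> ` {1..n}" unfolding set_l .
    then show "independent (set (map \<alpha> l @ [\<alpha> k]))" "span (set (map \<alpha> l @ [\<alpha> k])) = UNIV"
      using ind span by simp_all
  qed
  have B: "represents (map \<alpha> l) (map \<alpha> l) (reflections \<alpha> js) ?B"
    unfolding reflections_def l_def
    by (rule represents_sigma_product)
       (use js in \<open>auto simp: linear_reflect reflect_def cartan_matrix_def\<close>)
  have "\<exists>A'. represents (map \<alpha> l @ [\<alpha> k]) (map \<alpha> l @ [\<alpha> k]) (reflections \<alpha> js) A' \<and>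
      char_poly A' = char_poly ?B * char_poly (1\<^sub>m 1)"
  proof (rule represents_block_triangular[OF B])
    fix q assume "q < length [\<alpha> k]"
    then have q: "q = 0" by simp
    have "reflections \<alpha> js (\<alpha> k) - \<alpha> k \<in> span (\<alpha> ` ?J)"
      using reflections_diff_in_span[of \<alpha> js "\<alpha> k"] js by simp
    then obtain w where w: "reflections \<alpha> js (\<alpha> k) - \<alpha> k = (\<Sum>v\<in>\<alpha> ` ?J. w v *\<^sub>R v)"
      by (auto simp: span_finite)
    have "distinct (map \<alpha> l)" "set (map \<alpha> l) = \<alpha> ` ?J"
      using l inj_on_subset[OF inj, of ?J] by (auto simp: distinct_map)
    then have "(\<Sum>v\<in>\<alpha> ` ?J. w v *\<^sub>R v) = (\<Sum>p<length (map \<alpha> l). w (map \<alpha> l ! p) *\<^sub>R map \<alpha> l ! p)"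
      by (intro sum.reindex_bij_betw[symmetric] bij_betw_nth) auto
    then show "\<exists>x. reflections \<alpha> js ([\<alpha> k] ! q) = (\<Sum>p<length (map \<alpha> l). x p *\<^sub>R map \<alpha> l ! p)
        + (\<Sum>p<length [\<alpha> k]. (1\<^sub>m 1) $$ (p, q) *\<^sub>R [\<alpha> k] ! p)"
      using w by (intro exI[of _ "\<lambda>p. w (map \<alpha> l ! p)"]) (simp add: q algebra_simps)
  qed simp
  then obtain A' where A': "represents (map \<alpha> l @ [\<alpha> k]) (map \<alpha> l @ [\<alpha> k]) (reflections \<alpha> js) A'"
    "char_poly A' = char_poly ?B * char_poly (1\<^sub>m 1)" by blast
  have "char_poly A = char_poly A'"
    by (rule char_poly_linearly_conjugate[OF linearly_conjugate_refl linear_reflections bs cs A A'(1)])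
  then show ?thesis using A'(2) by (simp only: char_poly_one_1 mult.commute)
qed

lemma list_basis_zero:
  assumes "list_basis bs" "(\<Sum>p<length bs. x p *\<^sub>R bs ! p) = 0" "p < length bs"
  shows "x p = 0"
  using assms unfolding list_basis_def by blast

lemma list_basis_coordinates:
  assumes "list_basis bs"
  obtains x where "v = (\<Sum>p<length bs. x p *\<^sub>R bs ! p)"
  using assms unfolding list_basis_def by blast

text \<open>The coordinate of the added basis vector can be read off from the second component.\<close>

lemma list_basis_lift:
  fixes bs :: "'a::real_vector list" and a :: 'a
  assumes "list_basis bs"
  shows "list_basis ((a, 1::real) # map (\<lambda>v. (v, 0)) bs)"
proof -
  have sum: "(\<Sum>p<length ((a, 1::real) # map (\<lambda>v. (v, 0)) bs). x p *\<^sub>R ((a, 1) # map (\<lambda>v. (v, 0)) bs) ! p)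
      = (x 0 *\<^sub>R a + (\<Sum>p<length bs. x (Suc p) *\<^sub>R bs ! p), x 0)" for x :: "nat \<Rightarrow> real"
  proof -
    have "(\<Sum>p<length bs. x (Suc p) *\<^sub>R (bs ! p, 0::real)) = (\<Sum>p<length bs. x (Suc p) *\<^sub>R bs ! p, 0)"
      by (simp add: prod_eq_iff fst_sum snd_sum)
    then show ?thesis by (simp add: sum.lessThan_Suc_shift del: sum.lessThan_Suc)
  qed
  show ?thesis
    unfolding list_basis_def sum
  proof (intro conjI allI impI)
    fix x p
    assume z: "(x 0 *\<^sub>R a + (\<Sum>p<length bs. x (Suc p) *\<^sub>R bs ! p), x 0) = (0 :: 'a \<times> real)"
      and p: "p < length ((a, 1::real) # map (\<lambda>v. (v, 0)) bs)"
    have x0: "x 0 = 0" using z by (simp add: zero_prod_def)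
    then have "(\<Sum>p<length bs. x (Suc p) *\<^sub>R bs ! p) = 0" using z by (simp add: zero_prod_def)
    then have "x (Suc p) = 0" if "p < length bs" for p
      using list_basis_zero[OF assms, of "\<lambda>p. x (Suc p)"] that by blast
    then show "x p = 0" using x0 p by (cases p) auto
  next
    fix v :: "'a \<times> real"
    obtain y where y: "fst v - snd v *\<^sub>R a = (\<Sum>p<length bs. y p *\<^sub>R bs ! p)"
      using list_basis_coordinates[OF assms] by blast
    define x where "x p = (case p of 0 \<Rightarrow> snd v | Suc q \<Rightarrow> y q)" for p
    have "v = (x 0 *\<^sub>R a + (\<Sum>p<length bs. x (Suc p) *\<^sub>R bs ! p), x 0)"
      using y[symmetric] by (simp add: x_def prod_eq_iff)
    then show "\<exists>x. v = (x 0 *\<^sub>R a + (\<Sum>p<length bs. x (Suc p) *\<^sub>R bs ! p), x 0)"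
      by (intro exI[of _ x])
  qed
qed

text \<open>The formal space of the affine root system is modelled by the ambient space with one extra
  coordinate, where \<open>\<alpha>\<^sub>0\<close> is \<open>(-\<theta>, 1)\<close>. The null root \<open>(0, 1)\<close> is fixed by all
  reflections, which splits off one factor; on the quotient the affine product acts as a
  product of ordinary reflections.\<close>

lemma char_poly_affine:
  fixes \<alpha> :: "nat \<Rightarrow> 'a::euclidean_space"
  assumes inj: "inj_on \<alpha> {1..n}" and ind: "independent (\<alpha> ` {1..n})"
    and span: "span (\<alpha> ` {1..n}) = UNIV" and L: "set L = {0..n}"
    and bs: "list_basis bs" and A: "represents bs bs (reflections (\<alpha>(0 := - \<theta>)) L) A"
  shows "char_poly (foldr (\<lambda>j M. sigma_mat (affine_cartan_matrix \<alpha> \<theta>) {0..n} j * M) L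
      (1\<^sub>m (card {0..n}))) = [:-1, 1:] * char_poly A"
proof -
  define \<beta> where "\<beta> = \<alpha>(0 := - \<theta>)"
  define b where "b j = (\<beta> j, if j = 0 then 1 else 0 :: real)" for j
  define \<tau> where "\<tau> j x = x - cartan_pairing (fst x) (\<beta> j) *\<^sub>R b j" for j and x :: "'a \<times> real"
  let ?B = "foldr (\<lambda>j M. sigma_mat (affine_cartan_matrix \<alpha> \<theta>) {0..n} j * M) L (1\<^sub>m (card {0..n}))"
  have lin: "linear (\<tau> j)" for j
    unfolding \<tau>_def[abs_def]
    by (rule linearI)
       (simp_all add: linear_add[OF cartan_pairing_linear] linear_scale[OF cartan_pairing_linear]
          scaleR_add_left scaleR_diff_right algebra_simps)
  have lin_prod: "linear (foldr \<tau> js)" for js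
  proof (induction js)
    case Nil
    show ?case by (simp add: id_def linear_ident)
  next
    case (Cons j js)
    show ?case using linear_compose[OF Cons lin] by (simp add: o_def)
  qed
  have sorted: "sorted_list_of_set {0..n} = 0 # [1..<Suc n]"
    by (simp add: upt_conv_Cons del: upt_Suc flip: atLeastLessThanSuc_atLeastAtMost)
  have basis: "list_basis (map \<alpha> [1..<Suc n])"
    by (rule list_basis_of_independent)
       (use inj ind span in \<open>auto simp: distinct_map atLeastLessThanSuc_atLeastAtMost simp del: upt_Suc\<close>)
  define cs where "cs = map b (sorted_list_of_set {0..n})"
  have "cs = (- \<theta>, 1) # map (\<lambda>v. (v, 0)) (map \<alpha> [1..<Suc n])"
    unfolding cs_def sorted by (auto simp: b_def \<beta>_def)
  then have cs: "list_basis cs" using list_basis_lift[OF basis] by simp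
  have B: "represents cs cs (foldr \<tau> L) ?B"
    unfolding cs_def
    by (rule represents_sigma_product)
       (use L in \<open>auto simp: lin \<tau>_def b_def affine_cartan_matrix_def cartan_matrix_def \<beta>_def\<close>)
  define ds where "ds = (0, 1::real) # map (\<lambda>v. (v, 0)) bs"
  have ds: "list_basis ds" unfolding ds_def by (rule list_basis_lift[OF bs])
  have fst_prod: "fst (foldr \<tau> js x) = reflections \<beta> js (fst x)" for js x
    by (induction js) (simp_all add: \<tau>_def b_def reflect_def)
  have null: "foldr \<tau> js (0, 1) = (0, 1)" for js
    by (induction js) (simp_all add: \<tau>_def cartan_pairing_def)
  have A': "A \<in> carrier_mat (length bs) (length bs)" by (rule represents_carrier[OF A])
  have "represents [(0, 1)] [(0, 1)] (foldr \<tau> L) (1\<^sub>m 1)"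
    unfolding represents_def by (simp add: null)
  then have "\<exists>B'. represents ([(0, 1)] @ map (\<lambda>v. (v, 0)) bs) ([(0, 1)] @ map (\<lambda>v. (v, 0)) bs) (foldr \<tau> L) B'
      \<and> char_poly B' = char_poly (1\<^sub>m 1) * char_poly A"
  proof (rule represents_block_triangular)
    show "A \<in> carrier_mat (length (map (\<lambda>v. (v, 0::real)) bs)) (length (map (\<lambda>v. (v, 0::real)) bs))"
      using A' by simp
    fix q assume q: "q < length (map (\<lambda>v. (v, 0::real)) bs)"
    let ?y = "foldr \<tau> L (bs ! q, 0)"
    have "fst ?y = (\<Sum>p<length bs. A $$ (p, q) *\<^sub>R bs ! p)"
      using A q unfolding represents_def fst_prod \<beta>_def by simp
    then have "?y = (0, snd ?y) + (\<Sum>p<length bs. A $$ (p, q) *\<^sub>R (bs ! p, 0))"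
      by (simp add: prod_eq_iff fst_sum snd_sum)
    then show "\<exists>x. foldr \<tau> L (map (\<lambda>v. (v, 0)) bs ! q) = (\<Sum>p<length [(0, 1)]. x p *\<^sub>R [(0, 1)] ! p)
        + (\<Sum>p<length (map (\<lambda>v. (v, 0)) bs). A $$ (p, q) *\<^sub>R map (\<lambda>v. (v, 0)) bs ! p)"
      using q by (intro exI[of _ "\<lambda>p. snd ?y"]) (simp add: nth_map)
  qed
  then obtain B' where B': "represents ds ds (foldr \<tau> L) B'"
    "char_poly B' = char_poly (1\<^sub>m 1) * char_poly A" unfolding ds_def by auto
  have "char_poly ?B = char_poly B'"
    by (rule char_poly_linearly_conjugate[OF linearly_conjugate_refl lin_prod cs ds B B'(1)])
  then show ?thesis using B'(2) by (simp only: char_poly_one_1)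
qed

text \<open>With both factors split off, it remains to order the reflections so that the product for the
  affine diagram, taken modulo the null root, is conjugate to the product for the diagram without
  \<open>k\<close>.\<close>

lemma coxeter_polynomial_affine_if_conjugate:
  fixes \<alpha> :: "nat \<Rightarrow> 'a::euclidean_space"
  assumes inj: "inj_on \<alpha> {1..n}" and ind: "independent (\<alpha> ` {1..n})"
    and span: "span (\<alpha> ` {1..n}) = UNIV" and k: "k \<in> {1..n}" and js: "set js = {1..n} - {k}"
    and L: "set L = {0..n}" "distinct L"
    and conj: "linearly_conjugate (reflections (\<alpha>(0 := - \<theta>)) L) (reflections \<alpha> js)"
  shows "coxeter_polynomial (affine_cartan_matrix \<alpha> \<theta>) {0..n} ([:-1, 1:] ^ 2 *
    char_poly (foldr (\<lambda>j M. sigma_mat (cartan_matrix \<alpha>) ({1..n} - {k}) j * M) js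
      (1\<^sub>m (card ({1..n} - {k})))))"
proof -
  define bs where "bs = map \<alpha> [1..<Suc n]"
  have bs: "list_basis bs"
    unfolding bs_def
    by (rule list_basis_of_independent)
       (use inj ind span in \<open>auto simp: distinct_map atLeastLessThanSuc_atLeastAtMost simp del: upt_Suc\<close>)
  obtain A where A: "represents bs bs (reflections \<alpha> js) A" using represents_exists[OF bs] by blast
  obtain A' where A': "represents bs bs (reflections (\<alpha>(0 := - \<theta>)) L) A'"
    using represents_exists[OF bs] by blast
  have "char_poly A' = char_poly A"
    by (rule char_poly_linearly_conjugate[OF conj linear_reflections bs bs A' A])
  then show ?thesis
    unfolding coxeter_polynomial_def
    using char_poly_affine[OF inj ind span L(1) bs A'] char_poly_parabolic[OF inj ind span k js bs A] L
    by (intro exI[of _ L]) (simp only: power2_eq_square mult.assoc simp_thms)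
qed

section \<open>Root systems with a base\<close>

\<comment> \<open>The index set \<open>{1..n}\<close> would otherwise be rewritten to \<open>{Suc 0..n}\<close>.\<close>
declare One_nat_def [simp del]

locale based_root_system =
  fixes R :: "'a::euclidean_space set" and n :: nat and \<alpha> :: "nat \<Rightarrow> 'a"
  assumes roots: "root_system R" and base: "simple_roots R n \<alpha>"
begin

abbreviation C :: "nat \<Rightarrow> nat \<Rightarrow> real" where "C \<equiv> cartan_matrix \<alpha>"

definition coef :: "nat \<Rightarrow> 'a \<Rightarrow> real" where
  "coef i v = representation (\<alpha> ` {1..n}) v (\<alpha> i)"

definition positive :: "'a \<Rightarrow> bool" where
  "positive r \<longleftrightarrow> r \<in> R \<and> (\<forall>i\<in>{1..n}. 0 \<le> coef i r)"

lemma finite_roots: "finite R"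
  and zero_not_root: "0 \<notin> R"
  and cartan_pairing_Ints: "a \<in> R \<Longrightarrow> b \<in> R \<Longrightarrow> cartan_pairing b a \<in> \<int>"
  and root_multiple: "a \<in> R \<Longrightarrow> c *\<^sub>R a \<in> R \<Longrightarrow> c = 1 \<or> c = -1"
  and reflect_root: "a \<in> R \<Longrightarrow> b \<in> R \<Longrightarrow> reflect a b \<in> R"
  using roots unfolding root_system_def reflect_def by blast+

lemma inj_simple: "inj_on \<alpha> {1..n}"
  and independent_simple: "independent (\<alpha> ` {1..n})"
  and span_simple: "span (\<alpha> ` {1..n}) = UNIV"
  and simple_root: "i \<in> {1..n} \<Longrightarrow> \<alpha> i \<in> R"
  using base unfolding simple_roots_def by auto

lemma root_nonzero: "r \<in> R \<Longrightarrow> r \<noteq> 0"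
  using zero_not_root by blast

lemma root_norm: "r \<in> R \<Longrightarrow> inner r r > 0"
  using root_nonzero by simp

lemma simple_nonzero: "i \<in> {1..n} \<Longrightarrow> \<alpha> i \<noteq> 0"
  using simple_root root_nonzero by blast

lemma simple_norm: "i \<in> {1..n} \<Longrightarrow> inner (\<alpha> i) (\<alpha> i) > 0"
  using simple_nonzero by simp

lemma linear_coef: "linear (coef i)"
  unfolding coef_def[abs_def]
  by (rule linearI)
     (simp_all add: representation_add[OF independent_simple]
        representation_scale[OF independent_simple] span_simple)

lemmas coef_simps = linear_add[OF linear_coef] linear_diff[OF linear_coef]
  linear_neg[OF linear_coef] linear_scale[OF linear_coef] linear_sum[OF linear_coef]
  linear_0[OF linear_coef]

lemma coef_simple: "i \<in> {1..n} \<Longrightarrow> j \<in> {1..n} \<Longrightarrow> coef i (\<alpha> j) = (if i = j then 1 else 0)"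
  unfolding coef_def
  using representation_basis[OF independent_simple, of "\<alpha> j"] inj_simple
  by (auto simp: inj_on_eq_iff)

lemma coef_sum:
  assumes "i \<in> {1..n}"
  shows "coef i (\<Sum>j\<in>{1..n}. c j *\<^sub>R \<alpha> j) = c i"
proof -
  have "coef i (\<Sum>j\<in>{1..n}. c j *\<^sub>R \<alpha> j) = (\<Sum>j\<in>{1..n}. c j * coef i (\<alpha> j))"
    by (simp add: coef_simps)
  also have "\<dots> = (\<Sum>j\<in>{1..n}. if j = i then c j else 0)"
    using assms by (intro sum.cong) (auto simp: coef_simple)
  finally show ?thesis using assms by simp
qed

lemma coef_expansion: "v = (\<Sum>i\<in>{1..n}. coef i v *\<^sub>R \<alpha> i)"
proof -
  have "v \<in> span (\<alpha> ` {1..n})" by (simp add: span_simple)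
  then obtain w where "v = (\<Sum>b\<in>\<alpha> ` {1..n}. w b *\<^sub>R b)" by (auto simp: span_finite)
  then have v: "v = (\<Sum>i\<in>{1..n}. w (\<alpha> i) *\<^sub>R \<alpha> i)"
    by (simp add: sum.reindex[OF inj_simple])
  have "coef i v = w (\<alpha> i)" if "i \<in> {1..n}" for i
    by (subst v) (rule coef_sum[OF that])
  with v show ?thesis by simp
qed

lemma coef_eqI: "(\<And>i. i \<in> {1..n} \<Longrightarrow> coef i v = coef i w) \<Longrightarrow> v = w"
  using coef_expansion[of v] coef_expansion[of w] by (metis (no_types, lifting) sum.cong)

lemma inner_expansion: "inner v w = (\<Sum>i\<in>{1..n}. coef i v * inner (\<alpha> i) w)"
  by (subst coef_expansion[of v]) (simp add: inner_sum_left)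

lemma cartan_pairing_expansion:
  "cartan_pairing v a = (\<Sum>i\<in>{1..n}. coef i v * cartan_pairing (\<alpha> i) a)"
  by (subst coef_expansion[of v])
     (simp add: linear_sum[OF cartan_pairing_linear] linear_scale[OF cartan_pairing_linear])

lemma coef_reflect:
  "i \<in> {1..n} \<Longrightarrow> j \<in> {1..n} \<Longrightarrow>
    coef i (reflect (\<alpha> j) v) = (if i = j then coef i v - cartan_pairing v (\<alpha> j) else coef i v)"
  by (simp add: reflect_def coef_simps coef_simple)

lemma root_coef_sign:
  assumes "r \<in> R"
  shows "(\<forall>i\<in>{1..n}. 0 \<le> coef i r) \<or> (\<forall>i\<in>{1..n}. coef i r \<le> 0)"
proof -
  obtain c :: "nat \<Rightarrow> int" where c: "r = (\<Sum>i=1..n. of_int (c i) *\<^sub>R \<alpha> i)"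
    "(\<forall>i\<in>{1..n}. 0 \<le> c i) \<or> (\<forall>i\<in>{1..n}. c i \<le> 0)"
    using base assms unfolding simple_roots_def by blast
  have "coef i r = of_int (c i)" if "i \<in> {1..n}" for i
    unfolding c(1) by (rule coef_sum[OF that])
  with c(2) show ?thesis by auto
qed

lemma root_coef_pos_imp_positive: "r \<in> R \<Longrightarrow> i \<in> {1..n} \<Longrightarrow> 0 < coef i r \<Longrightarrow> positive r"
  unfolding positive_def using root_coef_sign[of r] by force

lemma positive_root: "positive r \<Longrightarrow> r \<in> R"
  unfolding positive_def by blast

lemma cartan_Ints: "i \<in> {1..n} \<Longrightarrow> j \<in> {1..n} \<Longrightarrow> C i j \<in> \<int>"
  unfolding cartan_matrix_def by (intro cartan_pairing_Ints simple_root)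

text \<open>The reflection of \<open>\<alpha> i\<close> in \<open>\<alpha> j\<close> has coefficient one at \<open>i\<close>, hence is positive.\<close>

lemma cartan_nonpos:
  assumes "i \<in> {1..n}" "j \<in> {1..n}" "i \<noteq> j"
  shows "C i j \<le> 0"
proof -
  have "positive (reflect (\<alpha> j) (\<alpha> i))"
    by (rule root_coef_pos_imp_positive[of _ i])
       (use assms in \<open>auto simp: reflect_root simple_root coef_reflect coef_simple\<close>)
  then have "0 \<le> coef j (reflect (\<alpha> j) (\<alpha> i))" using assms unfolding positive_def by blast
  then show ?thesis using assms by (simp add: coef_reflect coef_simple cartan_matrix_def)
qed

lemma inner_simple_nonpos:
  assumes "i \<in> {1..n}" "j \<in> {1..n}" "i \<noteq> j"
  shows "inner (\<alpha> i) (\<alpha> j) \<le> 0"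
  using cartan_nonpos[OF assms] simple_norm[of j] assms
  by (simp add: cartan_matrix_def cartan_pairing_def field_simps)

lemma cartan_eq_0_iff:
  assumes "i \<in> {1..n}" "j \<in> {1..n}"
  shows "C i j = 0 \<longleftrightarrow> inner (\<alpha> i) (\<alpha> j) = 0"
  using simple_nonzero[of j] assms by (simp add: cartan_matrix_def cartan_pairing_def)

lemma cartan_0_sym:
  assumes "i \<in> {1..n}" "j \<in> {1..n}"
  shows "C i j = 0 \<longleftrightarrow> C j i = 0"
  using cartan_eq_0_iff[OF assms] cartan_eq_0_iff[of j i] assms by (simp add: inner_commute)

lemma cartan_self: "i \<in> {1..n} \<Longrightarrow> C i i = 2"
  using simple_nonzero[of i] by (simp add: cartan_matrix_def cartan_pairing_def)

lemma cartan_le_minus_1: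
  assumes "i \<in> {1..n}" "j \<in> {1..n}" "i \<noteq> j" "C i j \<noteq> 0"
  shows "C i j \<le> -1"
proof -
  obtain z where z: "C i j = of_int z" using cartan_Ints assms by (metis Ints_cases)
  with cartan_nonpos[OF assms(1-3)] assms(4) show ?thesis by auto
qed

text \<open>A positive root other than \<open>\<alpha> j\<close> has a positive coefficient away from \<open>j\<close>, which the
  reflection does not change.\<close>

lemma positive_reflect_simple:
  assumes r: "positive r" and j: "j \<in> {1..n}" and neq: "r \<noteq> \<alpha> j"
  shows "positive (reflect (\<alpha> j) r)"
proof -
  have "\<exists>i\<in>{1..n}. i \<noteq> j \<and> 0 < coef i r"
  proof (rule ccontr)
    assume none: "\<not> ?thesis"
    have "coef i r = 0" if "i \<in> {1..n}" "i \<noteq> j" for i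
      using none that r unfolding positive_def by force
    then have "r = coef j r *\<^sub>R \<alpha> j"
      using j by (intro coef_eqI) (auto simp: coef_simps coef_simple)
    moreover from this have "coef j r = 1 \<or> coef j r = -1"
      using root_multiple[OF simple_root[OF j]] positive_root[OF r] by metis
    moreover have "0 \<le> coef j r" using r j unfolding positive_def by blast
    ultimately show False using neq by auto
  qed
  then obtain i where "i \<in> {1..n}" "i \<noteq> j" "0 < coef i r" by blast
  then show ?thesis
    using j positive_root[OF r]
    by (intro root_coef_pos_imp_positive[of _ i]) (auto simp: coef_reflect reflect_root simple_root)
qed

lemma reflections_root: "set js \<subseteq> {1..n} \<Longrightarrow> r \<in> R \<Longrightarrow> reflections \<alpha> js r \<in> R"
  by (induction js) (auto simp: reflect_root simple_root)

section \<open>Weights of edges and the forest property\<close>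

text \<open>This is \<open>4 cos\<^sup>2 \<phi>\<close> for the angle \<open>\<phi>\<close> between the two simple roots, the multiplicity of the edge.\<close>

definition weight :: "nat \<Rightarrow> nat \<Rightarrow> real" where
  "weight i j = C i j * C j i"

lemma weight_sym: "weight i j = weight j i"
  unfolding weight_def by simp

lemma weight_eq_0_iff:
  assumes "i \<in> {1..n}" "j \<in> {1..n}"
  shows "weight i j = 0 \<longleftrightarrow> C i j = 0"
  using cartan_0_sym[OF assms] unfolding weight_def by simp

text \<open>The strict Cauchy-Schwarz inequality.\<close>

lemma cartan_pairing_mult_less_4:
  fixes a b :: 'a
  assumes "a \<noteq> 0" "b \<noteq> 0" and "\<not> (\<exists>c. a = c *\<^sub>R b)"
  shows "cartan_pairing a b * cartan_pairing b a < 4"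
proof -
  define x where "x = inner b b *\<^sub>R a - inner a b *\<^sub>R b"
  have b: "0 < inner b b" using assms(2) by simp
  have "x \<noteq> 0"
  proof
    assume "x = 0"
    then have "a = (inner a b / inner b b) *\<^sub>R b"
      using assms(2) unfolding x_def by (simp add: eq_vector_fraction_iff)
    with assms(3) show False by blast
  qed
  then have "0 < inner x x" by simp
  also have "inner x x = inner b b * (inner a a * inner b b - (inner a b)\<^sup>2)"
    unfolding x_def
    by (simp add: inner_diff_left inner_diff_right inner_commute[of b a] power2_eq_square algebra_simps)
  finally have "(inner a b)\<^sup>2 < inner a a * inner b b" using b by (simp add: zero_less_mult_iff)
  then show ?thesis
    using assms(1,2)
    by (simp add: cartan_pairing_def inner_commute[of b a] divide_simps power2_eq_square
        mult.commute[of "inner b b"])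
qed

lemma simple_not_proportional:
  assumes "i \<in> {1..n}" "j \<in> {1..n}" "i \<noteq> j"
  shows "\<alpha> i \<noteq> c *\<^sub>R \<alpha> j"
proof
  assume "\<alpha> i = c *\<^sub>R \<alpha> j"
  then have "coef i (\<alpha> i) = c * coef i (\<alpha> j)" by (metis coef_simps(4) real_scaleR_def)
  with assms show False by (simp add: coef_simple)
qed

lemma weight_less_4:
  assumes "i \<in> {1..n}" "j \<in> {1..n}" "i \<noteq> j"
  shows "weight i j < 4"
  unfolding weight_def cartan_matrix_def
  using cartan_pairing_mult_less_4[OF simple_nonzero simple_nonzero] simple_not_proportional assms
  by blast

lemma weight_nonneg:
  assumes "i \<in> {1..n}" "j \<in> {1..n}" "i \<noteq> j"
  shows "0 \<le> weight i j"
  unfolding weight_def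
  by (rule mult_nonpos_nonpos) (use assms cartan_nonpos in auto)

lemma weight_Ints: "i \<in> {1..n} \<Longrightarrow> j \<in> {1..n} \<Longrightarrow> weight i j \<in> \<int>"
  unfolding weight_def by (intro Ints_mult cartan_Ints)

lemma weight_ge_1:
  assumes "i \<in> {1..n}" "j \<in> {1..n}" "i \<noteq> j" "C i j \<noteq> 0"
  shows "1 \<le> weight i j"
proof -
  obtain z where z: "weight i j = of_int z" using weight_Ints assms by (metis Ints_cases)
  moreover have "weight i j \<noteq> 0" using weight_eq_0_iff assms by blast
  ultimately show ?thesis using weight_nonneg[OF assms(1-3)] by auto
qed

lemma weight_cases:
  assumes "i \<in> {1..n}" "j \<in> {1..n}" "i \<noteq> j"
  shows "weight i j \<in> {0, 1, 2, 3}"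
proof -
  obtain z where z: "weight i j = of_int z" using weight_Ints assms by (metis Ints_cases)
  have "z \<in> {0, 1, 2, 3}" using weight_nonneg[OF assms] weight_less_4[OF assms] unfolding z by auto
  then show ?thesis unfolding z by auto
qed

definition unit :: "nat \<Rightarrow> 'a" where
  "unit i = \<alpha> i /\<^sub>R norm (\<alpha> i)"

lemma inner_unit_self: "i \<in> {1..n} \<Longrightarrow> inner (unit i) (unit i) = 1"
  using simple_nonzero[of i] unfolding unit_def
  by (simp add: power2_norm_eq_inner[symmetric] power2_eq_square)

lemma inner_unit:
  assumes "i \<in> {1..n}" "j \<in> {1..n}" "i \<noteq> j"
  shows "inner (unit i) (unit j) = - sqrt (weight i j) / 2"
proof -
  let ?x = "- 2 * inner (unit i) (unit j)"
  have n0: "norm (\<alpha> i) > 0" "norm (\<alpha> j) > 0" using assms simple_nonzero by auto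
  have sq: "inner (\<alpha> i) (\<alpha> i) = norm (\<alpha> i) * norm (\<alpha> i)" "inner (\<alpha> j) (\<alpha> j) = norm (\<alpha> j) * norm (\<alpha> j)"
    by (simp_all add: power2_norm_eq_inner[symmetric] power2_eq_square)
  have "?x\<^sup>2 = weight i j"
    using n0 unfolding weight_def cartan_matrix_def cartan_pairing_def unit_def sq
    by (simp add: inner_commute[of "\<alpha> j"] power2_eq_square field_simps)
  moreover have "0 \<le> ?x"
    using n0 inner_simple_nonpos[OF assms] unfolding unit_def
    by (simp add: mult_nonneg_nonpos)
  ultimately have "sqrt (weight i j) = ?x" by (metis real_sqrt_unique)
  then show ?thesis by simp
qed

lemma norm_unit_sum:
  assumes S: "S \<subseteq> {1..n}"
  shows "inner (\<Sum>i\<in>S. z i *\<^sub>R unit i) (\<Sum>i\<in>S. z i *\<^sub>R unit i)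
    = (\<Sum>i\<in>S. (z i)\<^sup>2) - (\<Sum>i\<in>S. \<Sum>j\<in>S - {i}. z i * z j * sqrt (weight i j)) / 2"
proof -
  have fin: "finite S" using S finite_subset by blast
  have "inner (\<Sum>i\<in>S. z i *\<^sub>R unit i) (\<Sum>i\<in>S. z i *\<^sub>R unit i)
      = (\<Sum>i\<in>S. \<Sum>j\<in>S. z i * z j * inner (unit i) (unit j))"
    by (simp add: inner_sum_left inner_sum_right sum_distrib_left mult_ac inner_commute)
  also have "\<dots> = (\<Sum>i\<in>S. (z i)\<^sup>2 + (\<Sum>j\<in>S - {i}. z i * z j * inner (unit i) (unit j)))"
  proof (rule sum.cong[OF refl])
    fix i assume i: "i \<in> S"
    then have "z i * z i * inner (unit i) (unit i) = (z i)\<^sup>2"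
      using S inner_unit_self by (auto simp: power2_eq_square)
    then show "(\<Sum>j\<in>S. z i * z j * inner (unit i) (unit j))
        = (z i)\<^sup>2 + (\<Sum>j\<in>S - {i}. z i * z j * inner (unit i) (unit j))"
      by (subst sum.remove[OF fin i]) simp
  qed
  also have "\<dots> = (\<Sum>i\<in>S. (z i)\<^sup>2 - (\<Sum>j\<in>S - {i}. z i * z j * sqrt (weight i j)) / 2)"
  proof (rule sum.cong[OF refl])
    fix i assume i: "i \<in> S"
    have "(\<Sum>j\<in>S - {i}. z i * z j * inner (unit i) (unit j))
        = (\<Sum>j\<in>S - {i}. - (z i * z j * sqrt (weight i j) / 2))"
    proof (rule sum.cong[OF refl])
      fix j assume "j \<in> S - {i}"
      then have "i \<in> {1..n}" "j \<in> {1..n}" "i \<noteq> j" using i S by auto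
      then show "z i * z j * inner (unit i) (unit j) = - (z i * z j * sqrt (weight i j) / 2)"
        by (simp add: inner_unit)
    qed
    then show "(z i)\<^sup>2 + (\<Sum>j\<in>S - {i}. z i * z j * inner (unit i) (unit j))
        = (z i)\<^sup>2 - (\<Sum>j\<in>S - {i}. z i * z j * sqrt (weight i j)) / 2"
      by (simp add: sum_negf sum_divide_distrib)
  qed
  finally show ?thesis by (simp add: sum_subtractf sum_divide_distrib)
qed

lemma unit_sum_nonzero:
  assumes "S \<subseteq> {1..n}" "i \<in> S" "z i \<noteq> 0"
  shows "0 < inner (\<Sum>i\<in>S. z i *\<^sub>R unit i) (\<Sum>i\<in>S. z i *\<^sub>R unit i)"
proof -
  have fin: "finite S" using assms(1) finite_subset by blast
  have i: "i \<in> {1..n}" using assms by blast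
  have "coef i (\<Sum>j\<in>S. z j *\<^sub>R unit j) = (\<Sum>j\<in>S. z j * (coef i (\<alpha> j) / norm (\<alpha> j)))"
    by (simp add: coef_simps unit_def divide_inverse mult_ac)
  also have "\<dots> = (\<Sum>j\<in>S. if j = i then z j / norm (\<alpha> j) else 0)"
    by (rule sum.cong) (use assms(1) i in \<open>auto simp: coef_simple\<close>)
  also have "\<dots> = z i / norm (\<alpha> i)" using assms(2) fin by simp
  finally have "coef i (\<Sum>j\<in>S. z j *\<^sub>R unit j) \<noteq> 0"
    using assms(3) simple_nonzero[OF i] by simp
  then have "(\<Sum>j\<in>S. z j *\<^sub>R unit j) \<noteq> 0" using coef_simps(6) by metis
  then show ?thesis by simp
qed

text \<open>Twice the number of edges inside \<open>S\<close>.\<close>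

definition valency_sum :: "nat set \<Rightarrow> nat" where
  "valency_sum S = (\<Sum>i\<in>S. card (neighbours C S i))"

lemma valency_sum_insert:
  assumes fin: "finite S" and S: "insert a S \<subseteq> {1..n}" and a: "a \<notin> S"
  shows "valency_sum (insert a S) = valency_sum S + 2 * card (neighbours C S a)"
proof -
  have "neighbours C (insert a S) i = (if C a i \<noteq> 0 then insert a (neighbours C S i) else neighbours C S i)"
    if "i \<in> S" for i
    using that S a cartan_0_sym[of a i] unfolding neighbours_def by auto
  then have "card (neighbours C (insert a S) i) = card (neighbours C S i) + (if C a i \<noteq> 0 then 1 else 0)"
    if "i \<in> S" for i
    using that a fin by (auto simp: neighbours_def)
  then have "(\<Sum>i\<in>S. card (neighbours C (insert a S) i))
      = valency_sum S + (\<Sum>i\<in>S. if C a i \<noteq> 0 then 1 else 0)"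
    unfolding valency_sum_def by (simp add: sum.distrib)
  moreover have "(\<Sum>i\<in>S. if C a i \<noteq> 0 then 1 else 0) = card (neighbours C S a)"
    using fin a by (simp add: neighbours_def sum.If_cases Int_def conj_commute)
      (metis (mono_tags, lifting))
  moreover have "neighbours C (insert a S) a = neighbours C S a"
    by (auto simp: neighbours_def)
  ultimately show ?thesis
    unfolding valency_sum_def using fin a by simp
qed

lemma even_valency_sum:
  assumes "S \<subseteq> {1..n}"
  shows "even (valency_sum S)"
  using finite_subset[OF assms finite_atLeastAtMost] assms
proof (induction S rule: finite_induct)
  case empty
  show ?case by (simp add: valency_sum_def)
next
  case (insert a S)
  then show ?case using valency_sum_insert[of S a] by simp
qed

text \<open>The sum of the normalised simple roots in \<open>S\<close> has positive norm, and each edge contributes at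
  most \<open>-1\<close> to it; so there are fewer edges than vertices.\<close>

lemma forest:
  assumes S: "S \<subseteq> {1..n}" and ne: "S \<noteq> {}"
  shows "valency_sum S + 2 \<le> 2 * card S"
proof -
  have fin: "finite S" using S finite_subset by blast
  obtain i where i: "i \<in> S" using ne by blast
  have "0 < (\<Sum>i\<in>S. (1::real)\<^sup>2) - (\<Sum>i\<in>S. \<Sum>j\<in>S - {i}. 1 * 1 * sqrt (weight i j)) / 2"
    using unit_sum_nonzero[OF S i, of "\<lambda>_. 1"] unfolding norm_unit_sum[OF S] by simp
  moreover have "real (valency_sum S) \<le> (\<Sum>i\<in>S. \<Sum>j\<in>S - {i}. sqrt (weight i j))"
    unfolding valency_sum_def of_nat_sum
  proof (rule sum_mono)
    fix i assume i: "i \<in> S"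
    have "real (card (neighbours C S i)) = (\<Sum>j\<in>neighbours C S i. 1)" by simp
    also have "\<dots> \<le> (\<Sum>j\<in>neighbours C S i. sqrt (weight i j))"
      by (rule sum_mono) (use i S in \<open>auto simp: neighbours_def intro!: weight_ge_1\<close>)
    also have "\<dots> \<le> (\<Sum>j\<in>S - {i}. sqrt (weight i j))"
      by (rule sum_mono2) (use fin i S in \<open>auto simp: neighbours_def intro!: weight_nonneg\<close>)
    finally show "real (card (neighbours C S i)) \<le> (\<Sum>j\<in>S - {i}. sqrt (weight i j))" .
  qed
  ultimately have "real (valency_sum S) < 2 * real (card S)" by simp
  then have "valency_sum S < 2 * card S" by linarith
  with even_valency_sum[OF S] show ?thesis by (auto elim!: evenE)
qed

end

section \<open>The highest root\<close>

lemma finite_ex_max: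
  fixes f :: "'b \<Rightarrow> real"
  assumes "finite A" "A \<noteq> {}"
  obtains x where "x \<in> A" "\<And>y. y \<in> A \<Longrightarrow> f y \<le> f x"
proof -
  have "Max (f ` A) \<in> f ` A" using assms by (intro Max_in) auto
  then obtain x where "x \<in> A" "f x = Max (f ` A)" by auto
  with that[of x] show ?thesis using assms by simp
qed

locale highest_root_system = based_root_system +
  fixes \<theta> :: 'a
  assumes highest: "highest_root R n \<alpha> \<theta>"
begin

lemma theta_root: "\<theta> \<in> R"
  using highest unfolding highest_root_def by blast

lemma coef_diff_theta:
  assumes "r \<in> R" "i \<in> {1..n}"
  shows "0 \<le> coef i (\<theta> - r)"
proof -
  obtain c :: "nat \<Rightarrow> nat" where "\<theta> - r = (\<Sum>i=1..n. of_nat (c i) *\<^sub>R \<alpha> i)"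
    using highest assms(1) unfolding highest_root_def by blast
  then show ?thesis using coef_sum[OF assms(2)] by simp
qed

lemma coef_theta_ge_1:
  assumes "i \<in> {1..n}"
  shows "1 \<le> coef i \<theta>"
  using coef_diff_theta[OF simple_root[OF assms] assms] assms by (simp add: coef_simps coef_simple)

lemma theta_dominant:
  assumes "i \<in> {1..n}"
  shows "0 \<le> cartan_pairing \<theta> (\<alpha> i)"
proof -
  have "0 \<le> coef i (\<theta> - reflect (\<alpha> i) \<theta>)"
    by (rule coef_diff_theta) (use assms in \<open>auto simp: reflect_root simple_root theta_root\<close>)
  then show ?thesis using assms by (simp add: coef_simps coef_reflect)
qed

lemma inner_theta_nonneg:
  assumes "i \<in> {1..n}"
  shows "0 \<le> inner (\<alpha> i) \<theta>"
  using theta_dominant[OF assms] simple_norm[OF assms]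
  by (simp add: cartan_pairing_def zero_le_divide_iff inner_commute)

lemma positive_theta:
  assumes "n \<ge> 1"
  shows "positive \<theta>"
  using coef_theta_ge_1 theta_root unfolding positive_def by force

text \<open>Among the longest roots one of maximal height is dominant, so it has non-negative inner
  product with its difference to \<open>\<theta>\<close>; so does \<open>\<theta>\<close>.\<close>

lemma theta_longest:
  assumes s: "s \<in> R"
  shows "inner s s \<le> inner \<theta> \<theta>"
proof -
  define A where "A = {r \<in> R. \<forall>s\<in>R. inner s s \<le> inner r r}"
  define ht where "ht v = (\<Sum>i\<in>{1..n}. coef i v)" for v
  have "R \<noteq> {}" using s by blast
  then obtain r0 where "r0 \<in> R" "\<And>y. y \<in> R \<Longrightarrow> inner y y \<le> inner r0 r0"
    using finite_ex_max[OF finite_roots, of "\<lambda>r. inner r r"] by metis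
  then have "A \<noteq> {}" unfolding A_def by blast
  moreover have "finite A" using finite_roots unfolding A_def by simp
  ultimately obtain r where r: "r \<in> A" and max: "\<And>y. y \<in> A \<Longrightarrow> ht y \<le> ht r"
    using finite_ex_max[of A ht] by metis
  have dom: "0 \<le> inner (\<alpha> j) r" if j: "j \<in> {1..n}" for j
  proof -
    have "reflect (\<alpha> j) r \<in> A" using r simple_root[OF j] unfolding A_def by (auto simp: reflect_root)
    then have "ht (reflect (\<alpha> j) r) \<le> ht r" by (rule max)
    moreover have "ht (reflect (\<alpha> j) r) = ht r - cartan_pairing r (\<alpha> j)"
    proof -
      have "ht (reflect (\<alpha> j) r) = (\<Sum>i\<in>{1..n}. coef i r - (if i = j then cartan_pairing r (\<alpha> j) else 0))"
        unfolding ht_def by (rule sum.cong) (use j in \<open>auto simp: coef_reflect\<close>)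
      then show ?thesis using j by (simp add: sum_subtractf ht_def)
    qed
    ultimately have "0 \<le> cartan_pairing r (\<alpha> j)" by simp
    then show ?thesis
      using simple_norm[OF j] by (simp add: cartan_pairing_def zero_le_divide_iff inner_commute)
  qed
  have "inner \<theta> \<theta> - inner r r = inner (\<theta> - r) \<theta> + inner (\<theta> - r) r"
    by (simp add: inner_diff_left inner_commute[of r \<theta>])
  also have "\<dots> = (\<Sum>i\<in>{1..n}. coef i (\<theta> - r) * (inner (\<alpha> i) \<theta> + inner (\<alpha> i) r))"
    by (subst (1 2) inner_expansion) (simp add: sum.distrib distrib_left)
  also have "\<dots> \<ge> 0"
    using r by (intro sum_nonneg mult_nonneg_nonneg add_nonneg_nonneg)
      (auto simp: A_def intro: coef_diff_theta inner_theta_nonneg dom)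
  finally have "inner r r \<le> inner \<theta> \<theta>" by simp
  then show ?thesis using r s unfolding A_def by force
qed

text \<open>The two pairings have the same sign and product below four, and the pairing with the longer root has
  the smaller absolute value.\<close>

lemma cartan_pairing_long_bound:
  assumes a: "a \<in> R" and b: "b \<in> R" and le: "inner a a \<le> inner b b" and ne: "a \<noteq> b" "a \<noteq> - b"
  shows "\<bar>cartan_pairing a b\<bar> \<le> 1"
proof (rule ccontr)
  assume "\<not> ?thesis"
  moreover obtain z where z: "cartan_pairing a b = of_int z"
    using cartan_pairing_Ints[OF b a] by (metis Ints_cases)
  ultimately have "1 < \<bar>z\<bar>" by simp
  then have "(of_int 2 :: real) \<le> of_int \<bar>z\<bar>" unfolding of_int_le_iff by simp
  then have big: "2 \<le> \<bar>cartan_pairing a b\<bar>" unfolding z by simp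
  have na: "0 < inner a a" and nb: "0 < inner b b" using a b root_norm by auto
  have "\<not> (\<exists>c. a = c *\<^sub>R b)" using root_multiple[OF b] a ne by force
  then have "cartan_pairing a b * cartan_pairing b a < 4"
    using cartan_pairing_mult_less_4[of a b] na nb by force
  moreover have "cartan_pairing b a = cartan_pairing a b * (inner b b / inner a a)"
    using na nb by (simp add: cartan_pairing_def inner_commute)
  ultimately have "(cartan_pairing a b)\<^sup>2 * (inner b b / inner a a) < 4"
    by (simp add: power2_eq_square mult.assoc)
  moreover have "(cartan_pairing a b)\<^sup>2 * 1 \<le> (cartan_pairing a b)\<^sup>2 * (inner b b / inner a a)"
    using le na by (intro mult_left_mono) (auto simp: le_divide_eq)
  moreover have "2\<^sup>2 \<le> \<bar>cartan_pairing a b\<bar>\<^sup>2" by (rule power_mono[OF big]) simp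
  ultimately show False by simp
qed

lemma cartan_pairing_long_root:
  assumes b: "b \<in> R" and long: "inner b b = inner \<theta> \<theta>" and a: "a \<in> R" and ne: "a \<noteq> b" "a \<noteq> - b"
  shows "\<bar>cartan_pairing a b\<bar> \<le> 1"
  using cartan_pairing_long_bound[OF a b _ ne] theta_longest[OF a] long by simp

section \<open>Connectedness of the Dynkin diagram\<close>

text \<open>Induction on the height: a positive root that is not simple is lowered by the reflection in
  some \<open>\<alpha> j\<close> with which its inner product is positive. The reflected root is not orthogonal to
  \<open>\<alpha> j\<close>, so \<open>j\<close> belongs to the part that supports it.\<close>

lemma support_unmixed:
  assumes AB: "A \<union> B = {1..n}" and orth: "\<And>a b. a \<in> A \<Longrightarrow> b \<in> B \<Longrightarrow> inner (\<alpha> a) (\<alpha> b) = 0"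
    and disj: "A \<inter> B = {}"
    and r: "positive r"
  shows "(\<forall>i\<in>A. coef i r = 0) \<or> (\<forall>i\<in>B. coef i r = 0)"
proof -
  have "\<forall>r. positive r \<and> (\<Sum>i\<in>{1..n}. coef i r) < real N \<longrightarrow>
      (\<forall>i\<in>A. coef i r = 0) \<or> (\<forall>i\<in>B. coef i r = 0)" for N :: nat
  proof (induction N)
    case 0
    show ?case
    proof (intro allI impI)
      fix r assume "positive r \<and> (\<Sum>i\<in>{1..n}. coef i r) < real 0"
      then have "positive r" "(\<Sum>i\<in>{1..n}. coef i r) < 0" by auto
      moreover from this(1) have "0 \<le> (\<Sum>i\<in>{1..n}. coef i r)"
        unfolding positive_def by (intro sum_nonneg) blast
      ultimately show "(\<forall>i\<in>A. coef i r = 0) \<or> (\<forall>i\<in>B. coef i r = 0)" by linarith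
    qed
  next
    case (Suc N)
    show ?case
    proof (intro allI impI)
      fix r assume "positive r \<and> (\<Sum>i\<in>{1..n}. coef i r) < real (Suc N)"
      then have r: "positive r" and ht: "(\<Sum>i\<in>{1..n}. coef i r) < real (Suc N)" by auto
      have "0 < (\<Sum>i\<in>{1..n}. coef i r * inner (\<alpha> i) r)"
        using root_norm[OF positive_root[OF r]] inner_expansion[of r r] by simp
      then obtain j where j: "j \<in> {1..n}" and jr: "0 < coef j r * inner (\<alpha> j) r"
        using sum_nonpos[of "{1..n}" "\<lambda>i. coef i r * inner (\<alpha> i) r"] by force
      have "0 \<le> coef j r" using r j unfolding positive_def by blast
      with jr have in_pos: "0 < inner (\<alpha> j) r" by (simp add: zero_less_mult_iff)
      show "(\<forall>i\<in>A. coef i r = 0) \<or> (\<forall>i\<in>B. coef i r = 0)"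
      proof (cases "r = \<alpha> j")
        case True
        have "i = j" if "i \<in> {1..n}" "coef i r \<noteq> 0" for i
          using that j unfolding True by (simp add: coef_simple split: if_splits)
        then show ?thesis using AB disj by blast
      next
        case False
        define s where "s = reflect (\<alpha> j) r"
        have s: "positive s" unfolding s_def by (rule positive_reflect_simple[OF r j False])
        have cp: "0 < cartan_pairing r (\<alpha> j)"
          using in_pos simple_norm[OF j] by (simp add: cartan_pairing_def inner_commute)
        obtain z where "cartan_pairing r (\<alpha> j) = of_int z"
          using cartan_pairing_Ints[OF simple_root[OF j] positive_root[OF r]] by (metis Ints_cases)
        with cp have cp1: "1 \<le> cartan_pairing r (\<alpha> j)" by simp
        have "(\<Sum>i\<in>{1..n}. coef i s)
            = (\<Sum>i\<in>{1..n}. coef i r - (if i = j then cartan_pairing r (\<alpha> j) else 0))"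
          unfolding s_def by (rule sum.cong) (use j in \<open>auto simp: coef_reflect\<close>)
        then have "(\<Sum>i\<in>{1..n}. coef i s) = (\<Sum>i\<in>{1..n}. coef i r) - cartan_pairing r (\<alpha> j)"
          using j by (simp add: sum_subtractf)
        then have "(\<Sum>i\<in>{1..n}. coef i s) < real N" using ht cp1 by simp
        with s Suc.IH have IH: "(\<forall>i\<in>A. coef i s = 0) \<or> (\<forall>i\<in>B. coef i s = 0)" by blast
        have "inner s (\<alpha> j) = inner r (reflect (\<alpha> j) (\<alpha> j))"
          using inner_reflect[of "\<alpha> j" s "\<alpha> j"] inner_reflect[of "\<alpha> j" r "reflect (\<alpha> j) (\<alpha> j)"]
          unfolding s_def by simp
        then have "inner s (\<alpha> j) < 0" using in_pos by (simp add: reflect_self inner_commute)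
        then have "(\<Sum>i\<in>{1..n}. coef i s * inner (\<alpha> i) (\<alpha> j)) \<noteq> 0"
          using inner_expansion[of s "\<alpha> j"] by simp
        then obtain i where i: "i \<in> {1..n}" "coef i s \<noteq> 0" "inner (\<alpha> i) (\<alpha> j) \<noteq> 0"
          by (metis (no_types, lifting) mult_eq_0_iff sum.not_neutral_contains_not_neutral)
        have "\<not> (i \<in> A \<and> j \<in> B)" using orth i(3) by blast
        moreover have "\<not> (i \<in> B \<and> j \<in> A)" using orth[of j i] i(3) by (auto simp: inner_commute)
        moreover have "i \<in> A \<union> B" "j \<in> A \<union> B" using i(1) j AB by auto
        ultimately have same: "i \<in> A \<longleftrightarrow> j \<in> A" "i \<in> B \<longleftrightarrow> j \<in> B" using disj by blast+
        have eq: "coef m r = coef m s" if "m \<in> {1..n}" "m \<noteq> j" for m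
          using that j unfolding s_def by (simp add: coef_reflect)
        from IH show ?thesis
        proof
          assume A0: "\<forall>m\<in>A. coef m s = 0"
          then have "j \<notin> A" using i(2) same by blast
          then have "coef m r = 0" if "m \<in> A" for m
          proof -
            have "m \<in> {1..n}" "m \<noteq> j" using that AB \<open>j \<notin> A\<close> by auto
            then show ?thesis using eq A0 that by simp
          qed
          then show ?thesis by blast
        next
          assume B0: "\<forall>m\<in>B. coef m s = 0"
          then have "j \<notin> B" using i(2) same by blast
          then have "coef m r = 0" if "m \<in> B" for m
          proof -
            have "m \<in> {1..n}" "m \<noteq> j" using that AB \<open>j \<notin> B\<close> by auto
            then show ?thesis using eq B0 that by simp
          qed
          then show ?thesis by blast
        qed
      qed
    qed
  qed
  moreover obtain N :: nat where "(\<Sum>i\<in>{1..n}. coef i r) < real N" using reals_Archimedean2 by blast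
  ultimately show ?thesis using r by blast
qed

lemma connected:
  assumes S: "S \<subseteq> {1..n}" "S \<noteq> {}" "S \<noteq> {1..n}"
  obtains u l where "u \<in> S" "l \<in> {1..n} - S" "C u l \<noteq> 0"
proof -
  have "\<exists>u\<in>S. \<exists>l\<in>{1..n} - S. C u l \<noteq> 0"
  proof (rule ccontr)
    assume "\<not> ?thesis"
    then have orth: "inner (\<alpha> a) (\<alpha> b) = 0" if "a \<in> S" "b \<in> {1..n} - S" for a b
      using that S(1) cartan_eq_0_iff[of a b] by blast
    have "n \<ge> 1" using S by (cases n) auto
    then have pos: "positive \<theta>" by (rule positive_theta)
    have "S \<union> ({1..n} - S) = {1..n}" "S \<inter> ({1..n} - S) = {}" using S(1) by auto
    then have "(\<forall>i\<in>S. coef i \<theta> = 0) \<or> (\<forall>i\<in>{1..n} - S. coef i \<theta> = 0)"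
      using support_unmixed[OF _ orth _ pos] by blast
    moreover obtain a b where "a \<in> S" "b \<in> {1..n} - S" using S by blast
    moreover have "coef i \<theta> \<noteq> 0" if "i \<in> {1..n}" for i using coef_theta_ge_1[OF that] by simp
    ultimately show False using S(1) by blast
  qed
  then show ?thesis using that by blast
qed

text \<open>The Dynkin diagram can be built up from any vertex by adding adjacent vertices.\<close>

lemma connected_induct:
  assumes k: "k \<in> {1..n}" and base: "P {k}"
    and step: "\<And>S u l. k \<in> S \<Longrightarrow> S \<subseteq> {1..n} \<Longrightarrow> P S \<Longrightarrow> u \<in> S \<Longrightarrow> l \<in> {1..n} - S \<Longrightarrow> C u l \<noteq> 0
      \<Longrightarrow> P (insert l S)"
  shows "P {1..n}"
proof -
  have "\<exists>S. k \<in> S \<and> S \<subseteq> {1..n} \<and> card S = Suc m \<and> P S" if "m < n" for m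
    using that
  proof (induction m)
    case 0
    show ?case using k base by (intro exI[of _ "{k}"]) auto
  next
    case (Suc m)
    then obtain S where S: "k \<in> S" "S \<subseteq> {1..n}" "card S = Suc m" "P S" by auto
    then have "S \<noteq> {1..n}" using Suc.prems by auto
    then obtain u l where ul: "u \<in> S" "l \<in> {1..n} - S" "C u l \<noteq> 0"
      using connected[of S] S by blast
    have "P (insert l S)" by (rule step) (use S ul in auto)
    moreover have "card (insert l S) = Suc (Suc m)"
      using ul S finite_subset[OF S(2)] by simp
    ultimately show ?case using S ul by (intro exI[of _ "insert l S"]) auto
  qed
  from this[of "n - 1"] k obtain S where "S \<subseteq> {1..n}" "card S = n" "P S" by force
  then show ?thesis using card_subset_eq[of "{1..n}" S] by simp
qed

text \<open>A connected forest is a tree.\<close>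

lemma valency_sum_all:
  assumes k: "k \<in> {1..n}"
  shows "valency_sum {1..n} + 2 = 2 * n"
proof -
  have "2 * card {1..n} \<le> valency_sum {1..n} + 2"
  proof (rule connected_induct[OF k])
    show "2 * card {k} \<le> valency_sum {k} + 2" by simp
  next
    fix S u l
    assume *: "S \<subseteq> {1..n}" "2 * card S \<le> valency_sum S + 2" "u \<in> S" "l \<in> {1..n} - S" "C u l \<noteq> 0"
    have fin: "finite S" using * finite_subset by blast
    have "u \<in> neighbours C S l" using * cartan_0_sym[of u l] unfolding neighbours_def by auto
    moreover have "finite (neighbours C S l)" using fin unfolding neighbours_def by simp
    ultimately have "card (neighbours C S l) \<noteq> 0" by auto
    then show "2 * card (insert l S) \<le> valency_sum (insert l S) + 2"
      using * fin by (subst valency_sum_insert) auto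
  qed
  moreover have "valency_sum {1..n} + 2 \<le> 2 * card {1..n}" by (rule forest) (use k in auto)
  ultimately show ?thesis by simp
qed

end

context based_root_system
begin

text \<open>Applying reflections to \<open>\<alpha> i\<close> lets the support spread along edges. The support stays inside a
  connected set \<open>S\<close> (expressed by its number of edges), and as there are no cycles a neighbour of
  \<open>i\<close> is reached from \<open>i\<close> alone, which determines its coefficient.\<close>

lemma reflections_star:
  assumes i: "i \<in> {1..n}" and zs: "distinct zs" "i \<notin> set zs" "set zs \<subseteq> {1..n}"
  shows "\<exists>S. S \<subseteq> insert i (set zs) \<and> i \<in> S \<and> 2 * card S \<le> valency_sum S + 2 \<and>
    (\<forall>v\<in>{1..n}. 0 \<le> coef v (reflections \<alpha> zs (\<alpha> i)) \<and>
      (v \<notin> S \<longrightarrow> coef v (reflections \<alpha> zs (\<alpha> i)) = 0)) \<and>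
    coef i (reflections \<alpha> zs (\<alpha> i)) = 1 \<and>
    (\<forall>v\<in>set zs. C i v \<noteq> 0 \<longrightarrow> coef v (reflections \<alpha> zs (\<alpha> i)) = - C i v)"
  using zs
proof (induction zs)
  case Nil
  show ?case using i by (intro exI[of _ "{i}"]) (auto simp: coef_simple)
next
  case (Cons a zs)
  define r where "r = reflections \<alpha> zs (\<alpha> i)"
  define p where "p = cartan_pairing r (\<alpha> a)"
  have a: "a \<in> {1..n}" "a \<notin> set zs" "a \<noteq> i" using Cons.prems by auto
  obtain S where S: "S \<subseteq> insert i (set zs)" "i \<in> S" "2 * card S \<le> valency_sum S + 2"
    and nonneg: "\<And>v. v \<in> {1..n} \<Longrightarrow> 0 \<le> coef v r"
    and zero: "\<And>v. v \<in> {1..n} \<Longrightarrow> v \<notin> S \<Longrightarrow> coef v r = 0"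
    and one: "coef i r = 1" and star: "\<And>v. v \<in> set zs \<Longrightarrow> C i v \<noteq> 0 \<Longrightarrow> coef v r = - C i v"
    using Cons.IH Cons.prems unfolding r_def by auto
  have aS: "a \<notin> S" using S(1) a by blast
  have SX: "S \<subseteq> {1..n}" using S(1) i Cons.prems(3) by auto
  have fin: "finite S" using SX finite_subset by blast
  have p: "p = (\<Sum>v\<in>S. coef v r * C v a)"
  proof -
    have "p = (\<Sum>v\<in>{1..n}. coef v r * C v a)"
      unfolding p_def by (subst cartan_pairing_expansion) (simp add: cartan_matrix_def)
    also have "\<dots> = (\<Sum>v\<in>S. coef v r * C v a)"
      by (rule sum.mono_neutral_right) (use SX zero in auto)
    finally show ?thesis .
  qed
  have terms: "coef v r * C v a \<le> 0" if "v \<in> S" for v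
  proof (rule mult_nonneg_nonpos)
    have v: "v \<in> {1..n}" "v \<noteq> a" using that SX aS by auto
    show "0 \<le> coef v r" by (rule nonneg[OF v(1)])
    show "C v a \<le> 0" by (rule cartan_nonpos[OF v(1) a(1) v(2)])
  qed
  have p_i: "p = C i a + (\<Sum>v\<in>S - {i}. coef v r * C v a)"
    unfolding p using sum.remove[OF fin S(2), of "\<lambda>v. coef v r * C v a"] one by simp
  have p_nonpos: "p \<le> 0" unfolding p by (rule sum_nonpos) (rule terms)
  have new: "coef v (reflections \<alpha> (a # zs) (\<alpha> i)) = (if v = a then - p else coef v r)"
    if "v \<in> {1..n}" for v
    using that a zero[OF a(1) aS] by (simp add: coef_reflect p_def r_def)
  \<comment> \<open>Two edges from \<open>a\<close> into \<open>S\<close> would close a cycle.\<close>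
  have nb: "card (neighbours C S a) \<le> 1"
  proof -
    have "valency_sum (insert a S) + 2 \<le> 2 * card (insert a S)"
      by (rule forest) (use SX a in auto)
    then show ?thesis using valency_sum_insert[OF fin _ aS] SX a S(3) fin aS by simp
  qed
  have fin_nb: "finite (neighbours C S a)" using fin unfolding neighbours_def by simp
  have nb_mem: "v \<in> neighbours C S a \<longleftrightarrow> v \<in> S \<and> C v a \<noteq> 0" for v
    using aS SX a cartan_0_sym[of a v] unfolding neighbours_def by auto
  have p_star: "p = C i a" if "C i a \<noteq> 0"
  proof -
    have "i \<in> neighbours C S a" using that S(2) nb_mem by blast
    then have "neighbours C S a = {i}"
      using nb fin_nb card_le_Suc0_iff_eq[OF fin_nb] by (auto simp: One_nat_def)
    then have "C v a = 0" if "v \<in> S - {i}" for v using that nb_mem by blast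
    then show ?thesis unfolding p_i by simp
  qed
  have star': "coef v (reflections \<alpha> (a # zs) (\<alpha> i)) = - C i v" if "v \<in> set (a # zs)" "C i v \<noteq> 0" for v
  proof -
    have "v \<in> {1..n}" using that Cons.prems(3) by auto
    then show ?thesis using new[of v] that star p_star by (cases "v = a") auto
  qed
  have one': "coef i (reflections \<alpha> (a # zs) (\<alpha> i)) = 1" using new[OF i] one a by simp
  have nonneg': "0 \<le> coef v (reflections \<alpha> (a # zs) (\<alpha> i))" if "v \<in> {1..n}" for v
    using new[OF that] nonneg[OF that] p_nonpos by simp
  show ?case
  proof (cases "p = 0")
    case True
    then have "coef v (reflections \<alpha> (a # zs) (\<alpha> i)) = 0" if "v \<in> {1..n}" "v \<notin> S" for v
      using new[OF that(1)] zero[OF that] by simp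
    then show ?thesis
      using S one' nonneg' star' by (intro exI[of _ S]) auto
  next
    case False
    then obtain u where "u \<in> S" "coef u r * C u a \<noteq> 0"
      unfolding p by (metis (no_types, lifting) sum.not_neutral_contains_not_neutral)
    then have "u \<in> neighbours C S a" using nb_mem by auto
    then have "card (neighbours C S a) \<noteq> 0" using fin_nb by auto
    then have "2 * card (insert a S) \<le> valency_sum (insert a S) + 2"
      using valency_sum_insert[OF fin _ aS] SX a S(3) fin aS by simp
    moreover have "coef v (reflections \<alpha> (a # zs) (\<alpha> i)) = 0" if "v \<in> {1..n}" "v \<notin> insert a S" for v
      using new[OF that(1)] zero[OF that(1)] that by simp
    ultimately show ?thesis
      using S one' nonneg' star' by (intro exI[of _ "insert a S"]) auto
  qed
qed

section \<open>Valencies and multiple edges\<close>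

definition valency :: "nat \<Rightarrow> nat" where
  "valency i = card (neighbours C {1..n} i)"

definition weighted_valency :: "nat \<Rightarrow> real" where
  "weighted_valency i = (\<Sum>j\<in>{1..n} - {i}. weight i j)"

text \<open>The left-hand side only involves the coefficients at \<open>i\<close> and at its neighbours, which
  \<open>reflections_star\<close> provides. The value does not depend on the order of the reflections.\<close>

lemma cartan_pairing_reflections_rest:
  assumes i: "i \<in> {1..n}" and zs: "distinct zs" "set zs = {1..n} - {i}"
  shows "cartan_pairing (reflections \<alpha> zs (\<alpha> i)) (\<alpha> i) = 2 - weighted_valency i"
proof -
  define r where "r = reflections \<alpha> zs (\<alpha> i)"
  have one: "coef i r = 1" and star: "\<And>v. v \<in> {1..n} - {i} \<Longrightarrow> C i v \<noteq> 0 \<Longrightarrow> coef v r = - C i v"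
    using reflections_star[OF i zs(1)] zs(2) unfolding r_def by auto
  have "cartan_pairing r (\<alpha> i) = (\<Sum>v\<in>{1..n}. coef v r * C v i)"
    by (subst cartan_pairing_expansion) (simp add: cartan_matrix_def)
  also have "\<dots> = 2 + (\<Sum>v\<in>{1..n} - {i}. coef v r * C v i)"
    using sum.remove[OF _ i, of "\<lambda>v. coef v r * C v i"] by (simp add: one cartan_self[OF i])
  also have "(\<Sum>v\<in>{1..n} - {i}. coef v r * C v i) = (\<Sum>v\<in>{1..n} - {i}. - weight i v)"
  proof (rule sum.cong[OF refl])
    fix v assume v: "v \<in> {1..n} - {i}"
    show "coef v r * C v i = - weight i v"
      using star[OF v] cartan_0_sym[OF i, of v] v unfolding weight_def by (cases "C i v = 0") auto
  qed
  finally show ?thesis unfolding r_def weighted_valency_def by (simp add: sum_negf)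
qed

lemma leaf_weighted_valency:
  assumes i: "i \<in> {1..n}" and leaf: "valency i = 1" and j: "j \<in> {1..n}" "j \<noteq> i" "C i j \<noteq> 0"
  shows "weighted_valency i = weight i j"
proof -
  have "j \<in> neighbours C {1..n} i" using j unfolding neighbours_def by simp
  then have nb: "neighbours C {1..n} i = {j}"
    using leaf unfolding valency_def by (metis card_1_singletonE singletonD)
  have "weight i v = 0" if "v \<in> {1..n} - {i} - {j}" for v
  proof -
    have "v \<notin> neighbours C {1..n} i" using nb that by blast
    then show ?thesis using that i weight_eq_0_iff[of i v] unfolding neighbours_def by blast
  qed
  then show ?thesis
    unfolding weighted_valency_def using j sum.remove[of "{1..n} - {i}" j "weight i"] by simp
qed

lemma valency_eq_sum: "real (valency i) = (\<Sum>j\<in>{1..n}. if j \<noteq> i \<and> C i j \<noteq> 0 then 1 else 0)"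
proof -
  have "(\<Sum>j\<in>{1..n}. if j \<noteq> i \<and> C i j \<noteq> 0 then 1 else 0 :: real)
      = (\<Sum>j\<in>neighbours C {1..n} i. 1)"
    unfolding neighbours_def by (rule sum.inter_filter[symmetric]) simp
  then show ?thesis unfolding valency_def by simp
qed

lemma weighted_valency_eq_sum:
  assumes "i \<in> {1..n}"
  shows "weighted_valency i = (\<Sum>j\<in>{1..n}. if j \<noteq> i then weight i j else 0)"
proof -
  have "(\<Sum>j\<in>{1..n}. if j \<noteq> i then weight i j else 0) = (\<Sum>j\<in>{1..n} - {i}. if j \<noteq> i then weight i j else 0)"
    using sum.remove[OF _ assms, of "\<lambda>j. if j \<noteq> i then weight i j else 0"] by simp
  then show ?thesis unfolding weighted_valency_def by simp
qed

end

context highest_root_system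
begin

lemma valency_ge_1:
  assumes n: "n \<ge> 2" and i: "i \<in> {1..n}"
  shows "1 \<le> valency i"
proof -
  have "{i} \<noteq> {1..n}"
  proof
    assume "{i} = {1..n}"
    then have "card {1..n} = 1" by (metis card_1_singleton_iff One_nat_def)
    then show False using n by simp
  qed
  then obtain l where "l \<in> {1..n} - {i}" "C i l \<noteq> 0" using connected[of "{i}"] i by blast
  then have "l \<in> neighbours C {1..n} i" unfolding neighbours_def by simp
  moreover have "finite (neighbours C {1..n} i)" unfolding neighbours_def by simp
  ultimately have "card (neighbours C {1..n} i) \<noteq> 0" by auto
  then show ?thesis unfolding valency_def by simp
qed

lemma leaves_not_adjacent:
  assumes n: "n \<ge> 3" and i: "i \<in> {1..n}" and j: "j \<in> {1..n}" "j \<noteq> i" "C i j \<noteq> 0"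
    and leaf: "valency i = 1" "valency j = 1"
  shows False
proof -
  have nb: "neighbours C {1..n} i = {j}" "neighbours C {1..n} j = {i}"
  proof -
    have "j \<in> neighbours C {1..n} i" "i \<in> neighbours C {1..n} j"
      using i j cartan_0_sym[of i j] unfolding neighbours_def by auto
    then show "neighbours C {1..n} i = {j}" "neighbours C {1..n} j = {i}"
      using leaf unfolding valency_def by (metis card_1_singletonE singletonD)+
  qed
  have "card {i, j} < card {1..n}" using n j by simp
  then have "card {i, j} \<noteq> card {1..n}" by simp
  then have "{i, j} \<noteq> {1..n}" by metis
  then obtain u l where ul: "u \<in> {i, j}" "l \<in> {1..n} - {i, j}" "C u l \<noteq> 0"
    using connected[of "{i, j}"] i j by blast
  then have "l \<in> neighbours C {1..n} u" unfolding neighbours_def by auto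
  then show False using ul nb by auto
qed

text \<open>The norm of the combination of the normalised simple roots with coefficient \<open>2\<close> at inner
  vertices and \<open>sqrt (weighted_valency i)\<close> at each leaf \<open>i\<close> is positive. For a leaf this
  coefficient minimises the norm, given coefficient \<open>2\<close> at its only neighbour. The second sum counts
  each edge of weight \<open>w\<close> with \<open>w - 1\<close> at both ends.\<close>

lemma leaf_inequality:
  assumes n: "n \<ge> 3"
  shows "2 * real (card {i \<in> {1..n}. valency i = 1}) +
    (\<Sum>i\<in>{1..n}. weighted_valency i - real (valency i)) < 8"
proof -
  let ?X = "{1..n}"
  define lf where "lf i = (if valency i = 1 then 1 else 0 :: real)" for i
  define z where "z i = (if valency i = 1 then sqrt (weighted_valency i) else 2)" for i
  define A where "A i j = (if j \<noteq> i \<and> C i j \<noteq> 0 then 1 else 0 :: real)" for i j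
  define W where "W i j = (if j \<noteq> i then weight i j else 0)" for i j
  have degA: "(\<Sum>j\<in>?X. A i j) = real (valency i)" for i
    unfolding A_def by (rule valency_eq_sum[symmetric])
  have wdegW: "(\<Sum>j\<in>?X. W i j) = weighted_valency i" if "i \<in> ?X" for i
    unfolding W_def by (rule weighted_valency_eq_sum[OF that, symmetric])
  have symA: "A i j = A j i" if "i \<in> ?X" "j \<in> ?X" for i j
    unfolding A_def using cartan_0_sym[OF that] by auto
  have symW: "W i j = W j i" for i j unfolding W_def using weight_sym[of i j] by auto
  \<comment> \<open>The coefficient \<open>4 - 2 * lf i - 2 * lf j\<close> is the product of the values \<open>2 - lf i\<close> and \<open>2 - lf j\<close>,
    except at a pair of leaves, which cannot be adjacent.\<close>
  have pair: "A i j * (4 - 2 * lf i - 2 * lf j) + (W i j - A i j) * (1 + lf i + lf j)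
      \<le> (if j \<noteq> i then z i * z j * sqrt (weight i j) else 0)" if ij: "i \<in> ?X" "j \<in> ?X" for i j
  proof (cases "j \<noteq> i \<and> C i j \<noteq> 0")
    case False
    then show ?thesis using weight_eq_0_iff[OF ij] by (auto simp: A_def W_def)
  next
    case True
    then have adj: "j \<noteq> i" "C i j \<noteq> 0" by auto
    have w: "weight i j \<in> {1, 2, 3}"
      using weight_cases[OF ij] weight_ge_1[OF ij] adj by auto
    then have w0: "0 \<le> weight i j" by auto
    have adj': "i \<noteq> j" "C j i \<noteq> 0" using adj cartan_0_sym[OF ij] by auto
    consider "valency i = 1" "valency j \<noteq> 1" | "valency i \<noteq> 1" "valency j = 1"
      | "valency i \<noteq> 1" "valency j \<noteq> 1"
      using leaves_not_adjacent[OF n ij adj] by blast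
    then show ?thesis
    proof cases
      case 1
      then have "weighted_valency i = weight i j" using leaf_weighted_valency[OF ij(1) _ ij(2) adj] by blast
      then show ?thesis using 1 True w0 by (simp add: A_def W_def lf_def z_def)
    next
      case 2
      then have "weighted_valency j = weight i j"
        using leaf_weighted_valency[OF ij(2) _ ij(1) adj'] weight_sym[of i j] by simp
      then show ?thesis using 2 True w0 by (simp add: A_def W_def lf_def z_def)
    next
      case 3
      \<comment> \<open>Concavity of the square root on the weights \<open>1\<close>, \<open>2\<close>, \<open>3\<close>, with equality at \<open>1\<close>.\<close>
      have "(3 + weight i j) / 4 \<le> sqrt (weight i j)"
        by (rule real_le_rsqrt) (use w in \<open>auto simp: power2_eq_square\<close>)
      then have "3 + weight i j \<le> 4 * sqrt (weight i j)"
        by (simp add: pos_divide_le_eq mult.commute)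
      then show ?thesis using 3 True by (simp add: A_def W_def lf_def z_def)
    qed
  qed
  have "inner (\<Sum>i\<in>?X. z i *\<^sub>R unit i) (\<Sum>i\<in>?X. z i *\<^sub>R unit i) > 0"
  proof (rule unit_sum_nonzero)
    show "z 1 \<noteq> 0"
    proof (cases "valency 1 = 1")
      case True
      have "1 \<in> ?X" using n by simp
      have "neighbours C ?X 1 \<noteq> {}" using True unfolding valency_def by force
      then obtain j where j: "j \<in> ?X" "j \<noteq> 1" "C 1 j \<noteq> 0" unfolding neighbours_def by auto
      then have "weighted_valency 1 = weight 1 j"
        using leaf_weighted_valency[OF \<open>1 \<in> ?X\<close> True j] by blast
      then show ?thesis using weight_ge_1[of 1 j] j \<open>1 \<in> ?X\<close> by (simp add: z_def)
    qed (simp add: z_def)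
  qed (use n in auto)
  then have pos: "(\<Sum>i\<in>?X. \<Sum>j\<in>?X - {i}. z i * z j * sqrt (weight i j)) < 2 * (\<Sum>i\<in>?X. (z i)\<^sup>2)"
    unfolding norm_unit_sum[OF subset_refl] by simp
  have "(\<Sum>i\<in>?X. \<Sum>j\<in>?X - {i}. z i * z j * sqrt (weight i j))
      = (\<Sum>i\<in>?X. \<Sum>j\<in>?X. if j \<noteq> i then z i * z j * sqrt (weight i j) else 0)"
  proof (rule sum.cong[OF refl])
    fix i assume i: "i \<in> ?X"
    show "(\<Sum>j\<in>?X - {i}. z i * z j * sqrt (weight i j))
        = (\<Sum>j\<in>?X. if j \<noteq> i then z i * z j * sqrt (weight i j) else 0)"
      by (rule sum.mono_neutral_cong_left) (use i in auto)
  qed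
  moreover have "(\<Sum>i\<in>?X. \<Sum>j\<in>?X. A i j * (4 - 2 * lf i - 2 * lf j) + (W i j - A i j) * (1 + lf i + lf j))
      \<le> (\<Sum>i\<in>?X. \<Sum>j\<in>?X. if j \<noteq> i then z i * z j * sqrt (weight i j) else 0)"
    by (intro sum_mono pair)
  moreover have "(\<Sum>i\<in>?X. \<Sum>j\<in>?X. A i j * (4 - 2 * lf i - 2 * lf j) + (W i j - A i j) * (1 + lf i + lf j))
      = (\<Sum>i\<in>?X. (4 - 4 * lf i) * real (valency i) + (1 + 2 * lf i) * (weighted_valency i - real (valency i)))"
  proof -
    define B where "B i j = (W i j - A i j) - 2 * A i j" for i j
    have "(\<Sum>i\<in>?X. \<Sum>j\<in>?X. A i j * (4 - 2 * lf i - 2 * lf j) + (W i j - A i j) * (1 + lf i + lf j))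
        = (\<Sum>i\<in>?X. \<Sum>j\<in>?X. (W i j + 3 * A i j) + lf i * B i j + lf j * B i j)"
      by (intro sum.cong refl) (simp add: B_def algebra_simps)
    also have "\<dots> = (\<Sum>i\<in>?X. \<Sum>j\<in>?X. (W i j + 3 * A i j) + lf i * B i j) + (\<Sum>i\<in>?X. \<Sum>j\<in>?X. lf j * B i j)"
      by (simp add: sum.distrib)
    also have "(\<Sum>i\<in>?X. \<Sum>j\<in>?X. lf j * B i j) = (\<Sum>i\<in>?X. \<Sum>j\<in>?X. lf i * B i j)"
      by (subst sum.swap, intro sum.cong refl) (simp add: B_def symA symW)
    also have "(\<Sum>i\<in>?X. \<Sum>j\<in>?X. (W i j + 3 * A i j) + lf i * B i j) + \<dots>
        = (\<Sum>i\<in>?X. \<Sum>j\<in>?X. (W i j + 3 * A i j) + 2 * lf i * B i j)"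
      by (simp add: sum.distrib[symmetric] algebra_simps)
    also have "\<dots> = (\<Sum>i\<in>?X. (weighted_valency i + 3 * real (valency i))
        + 2 * lf i * (weighted_valency i - real (valency i) - 2 * real (valency i)))"
    proof (rule sum.cong[OF refl])
      fix i assume i: "i \<in> ?X"
      show "(\<Sum>j\<in>?X. (W i j + 3 * A i j) + 2 * lf i * B i j) = (weighted_valency i + 3 * real (valency i))
          + 2 * lf i * (weighted_valency i - real (valency i) - 2 * real (valency i))"
        unfolding B_def
        by (simp add: sum.distrib sum_subtractf sum_distrib_left[symmetric] degA wdegW[OF i])
    qed
    also have "\<dots> = (\<Sum>i\<in>?X. (4 - 4 * lf i) * real (valency i) + (1 + 2 * lf i) * (weighted_valency i - real (valency i)))"
      by (intro sum.cong refl) (simp add: algebra_simps)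
    finally show ?thesis .
  qed
  ultimately have "0 < (\<Sum>i\<in>?X. 2 * (z i)\<^sup>2
      - ((4 - 4 * lf i) * real (valency i) + (1 + 2 * lf i) * (weighted_valency i - real (valency i))))"
    using pos by (simp add: sum_subtractf sum_distrib_left)
  also have "\<dots> = (\<Sum>i\<in>?X. 8 - 4 * real (valency i) - 2 * lf i - (weighted_valency i - real (valency i)))"
  proof (rule sum.cong[OF refl])
    fix i assume i: "i \<in> ?X"
    have "0 \<le> weighted_valency i"
      unfolding weighted_valency_def by (rule sum_nonneg) (use i in \<open>auto intro!: weight_nonneg\<close>)
    then show "2 * (z i)\<^sup>2 - ((4 - 4 * lf i) * real (valency i) + (1 + 2 * lf i) * (weighted_valency i - real (valency i)))
        = 8 - 4 * real (valency i) - 2 * lf i - (weighted_valency i - real (valency i))"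
      by (simp add: z_def lf_def algebra_simps)
  qed
  also have "\<dots> = 8 * real n - 4 * real (valency_sum ?X) - 2 * (\<Sum>i\<in>?X. lf i)
      - (\<Sum>i\<in>?X. weighted_valency i - real (valency i))"
    unfolding valency_sum_def valency_def[symmetric]
    by (simp add: sum_subtractf sum.distrib sum_negf sum_distrib_left[symmetric])
  also have "real (valency_sum ?X) = 2 * real n - 2"
    using valency_sum_all[of 1] n by simp
  also have "(\<Sum>i\<in>?X. lf i) = real (card {i \<in> ?X. valency i = 1})"
  proof -
    have "(\<Sum>i\<in>?X. lf i) = (\<Sum>i\<in>{i \<in> ?X. valency i = 1}. 1)"
      unfolding lf_def by (rule sum.inter_filter[symmetric]) simp
    then show ?thesis by simp
  qed
  finally show ?thesis by simp
qed

text \<open>In a tree the deviations of the valencies from two add up to \<open>-2\<close>, and a leaf contributes \<open>-1\<close>.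
  The subtraction on the natural numbers makes the summands on the left vanish at leaves.\<close>

lemma leaf_count:
  assumes n: "n \<ge> 3" and S: "S \<subseteq> {1..n}"
  shows "2 + (\<Sum>i\<in>S. real (valency i - 2)) \<le> real (card {i \<in> {1..n}. valency i = 1})"
proof -
  let ?X = "{1..n}"
  have "(\<Sum>i\<in>S. real (valency i - 2)) \<le> (\<Sum>i\<in>?X. real (valency i - 2))"
    by (rule sum_mono2) (use S in auto)
  also have "\<dots> = (\<Sum>i\<in>?X. (real (valency i) - 2) + (if valency i = 1 then 1 else 0))"
  proof (rule sum.cong[OF refl])
    fix i assume "i \<in> ?X"
    then have "1 \<le> valency i" using valency_ge_1 n by simp
    then show "real (valency i - 2) = (real (valency i) - 2) + (if valency i = 1 then 1 else 0)"
      by (cases "valency i = 1") auto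
  qed
  also have "\<dots> = real (valency_sum ?X) - 2 * real n + (\<Sum>i\<in>?X. if valency i = 1 then 1 else 0)"
    unfolding valency_sum_def valency_def[symmetric] by (simp add: sum.distrib sum_subtractf)
  also have "real (valency_sum ?X) = 2 * real n - 2"
    using valency_sum_all[of 1] n by simp
  also have "(\<Sum>i\<in>?X. if valency i = 1 then 1 else 0 :: real) = (\<Sum>i\<in>{i \<in> ?X. valency i = 1}. 1)"
    by (rule sum.inter_filter[symmetric]) simp
  finally show ?thesis by simp
qed

text \<open>\<open>P\<close> consists of ordered pairs: a multiple edge may be counted once in each direction.\<close>

lemma excess_ge:
  assumes P: "P \<subseteq> {1..n} \<times> {1..n}" and heavy: "\<And>i j. (i, j) \<in> P \<Longrightarrow> i \<noteq> j \<and> 2 \<le> weight i j"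
  shows "real (card P) \<le> (\<Sum>i\<in>{1..n}. weighted_valency i - real (valency i))"
proof -
  let ?X = "{1..n}"
  define e where "e i j = (if j \<noteq> i then weight i j else 0) - (if j \<noteq> i \<and> C i j \<noteq> 0 then 1 else 0)" for i j
  have e0: "0 \<le> e i j" if "i \<in> ?X" "j \<in> ?X" for i j
    using weight_nonneg[OF that] weight_ge_1[OF that] unfolding e_def by auto
  have "real (card P) = (\<Sum>x\<in>P. 1)" by simp
  also have "\<dots> \<le> (\<Sum>(i, j)\<in>P. e i j)"
  proof (rule sum_mono)
    fix x assume x: "x \<in> P"
    obtain i j where ij: "x = (i, j)" by (cases x)
    then have "i \<noteq> j" "2 \<le> weight i j" using heavy x by auto
    then show "1 \<le> (case x of (i, j) \<Rightarrow> e i j)" unfolding ij e_def by simp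
  qed
  also have "\<dots> \<le> (\<Sum>(i, j)\<in>?X \<times> ?X. e i j)"
    by (rule sum_mono2) (use P e0 in auto)
  also have "\<dots> = (\<Sum>i\<in>?X. \<Sum>j\<in>?X. e i j)" by (simp add: sum.cartesian_product)
  also have "\<dots> = (\<Sum>i\<in>?X. weighted_valency i - real (valency i))"
    by (intro sum.cong refl)
       (simp add: e_def sum_subtractf valency_eq_sum weighted_valency_eq_sum)
  finally show ?thesis .
qed

lemma at_most_one_branching:
  assumes n: "n \<ge> 3" and ij: "i \<in> {1..n}" "j \<in> {1..n}" "i \<noteq> j"
    and deg: "3 \<le> valency i" "3 \<le> valency j"
  shows False
proof -
  have "2 + (\<Sum>i\<in>{i, j}. real (valency i - 2)) \<le> real (card {i \<in> {1..n}. valency i = 1})"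
    by (rule leaf_count[OF n]) (use ij in auto)
  then have "4 \<le> real (card {i \<in> {1..n}. valency i = 1})" using ij deg by simp
  then show False using leaf_inequality[OF n] excess_ge[of "{}"] by simp
qed

lemma no_branching_with_heavy_edge:
  assumes n: "n \<ge> 3" and i: "i \<in> {1..n}" "3 \<le> valency i"
    and ab: "a \<in> {1..n}" "b \<in> {1..n}" "a \<noteq> b" "2 \<le> weight a b"
  shows False
proof -
  have "2 + (\<Sum>i\<in>{i}. real (valency i - 2)) \<le> real (card {i \<in> {1..n}. valency i = 1})"
    by (rule leaf_count[OF n]) (use i in auto)
  then have "3 \<le> real (card {i \<in> {1..n}. valency i = 1})" using i by simp
  moreover have "real (card {(a, b), (b, a)}) \<le> (\<Sum>i\<in>{1..n}. weighted_valency i - real (valency i))"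
    by (rule excess_ge) (use ab weight_sym[of a b] in auto)
  moreover have "card {(a, b), (b, a)} = 2" using ab by simp
  ultimately show False using leaf_inequality[OF n] by simp
qed

lemma heavy_edge_unique:
  assumes n: "n \<ge> 3"
    and ab: "a \<in> {1..n}" "b \<in> {1..n}" "a \<noteq> b" "2 \<le> weight a b"
    and cd: "c \<in> {1..n}" "d \<in> {1..n}" "c \<noteq> d" "2 \<le> weight c d"
  shows "{a, b} = {c, d}"
proof (rule ccontr)
  assume ne: "{a, b} \<noteq> {c, d}"
  have "2 \<le> real (card {i \<in> {1..n}. valency i = 1})" using leaf_count[OF n, of "{}"] by simp
  moreover have "real (card {(a, b), (b, a), (c, d), (d, c)}) \<le> (\<Sum>i\<in>{1..n}. weighted_valency i - real (valency i))"
    by (rule excess_ge) (use ab cd weight_sym[of a b] weight_sym[of c d] in auto)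
  moreover have "card {(a, b), (b, a), (c, d), (d, c)} = 4"
    using ab cd ne by (auto simp: card_insert_if doubleton_eq_iff)
  ultimately show False using leaf_inequality[OF n] by simp
qed

end

section \<open>Reordering products of reflections\<close>

text \<open>Rotations correspond to conjugations, so related words have conjugate products of reflections if
  the reflections of letters related by \<open>c\<close> commute.\<close>

inductive reorder :: "(nat \<Rightarrow> nat \<Rightarrow> bool) \<Rightarrow> nat list \<Rightarrow> nat list \<Rightarrow> bool" for c where
  same: "reorder c xs xs"
| swap_commuting: "c a b \<Longrightarrow> reorder c (xs @ a # b # ys) (xs @ b # a # ys)"
| rotate_first: "reorder c (a # xs) (xs @ [a])"
| then_reorder: "reorder c xs ys \<Longrightarrow> reorder c ys zs \<Longrightarrow> reorder c xs zs"

lemma reorder_set: "reorder c xs ys \<Longrightarrow> set xs = set ys \<and> (distinct xs \<longleftrightarrow> distinct ys)"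
  by (induction rule: reorder.induct) auto

lemma reorder_rotate_append: "reorder c (xs @ ys) (ys @ xs)"
proof (induction xs arbitrary: ys)
  case Nil
  show ?case by (simp add: reorder.same)
next
  case (Cons a xs)
  have "reorder c (a # xs @ ys) ((xs @ ys) @ [a])" by (rule reorder.rotate_first)
  moreover have "reorder c (xs @ ys @ [a]) ((ys @ [a]) @ xs)" using Cons[of "ys @ [a]"] by simp
  ultimately show ?case using reorder.then_reorder by fastforce
qed

lemma reorder_move_front:
  assumes "\<And>x. x \<in> set xs \<Longrightarrow> c x v"
  shows "reorder c (us @ xs @ v # vs) (us @ v # xs @ vs)"
  using assms
proof (induction xs arbitrary: us)
  case Nil
  show ?case by (simp add: reorder.same)
next
  case (Cons x xs)
  have "reorder c ((us @ [x]) @ xs @ v # vs) ((us @ [x]) @ v # xs @ vs)"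
    by (rule Cons.IH) (use Cons.prems in auto)
  moreover have "reorder c (us @ x # v # (xs @ vs)) (us @ v # x # (xs @ vs))"
    by (rule reorder.swap_commuting) (use Cons.prems in auto)
  ultimately show ?case using reorder.then_reorder by fastforce
qed

text \<open>If \<open>v\<close> commutes with all letters but \<open>m\<close>, then rotating a letter to the end of \<open>xs\<close> can be
  imitated in front of \<open>v\<close>: any letter other than \<open>m\<close> is rotated past \<open>v\<close> and exchanged with it,
  and for \<open>m\<close> it is \<open>v\<close> that is first moved through all other letters and then rotated with \<open>m\<close>.\<close>

lemma reorder_snoc:
  assumes "reorder c xs ys" "distinct xs"
    and "\<And>x. x \<in> set xs \<Longrightarrow> x \<noteq> m \<Longrightarrow> c x v \<and> c v x"
  shows "reorder c (xs @ [v]) (ys @ [v])"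
  using assms
proof (induction rule: reorder.induct)
  case (same xs)
  show ?case by (rule reorder.same)
next
  case (swap_commuting a b xs ys)
  then show ?case using reorder.swap_commuting[of c a b xs "ys @ [v]"] by simp
next
  case (rotate_first a xs)
  show ?case
  proof (cases "a = m")
    case False
    have "reorder c (a # xs @ [v]) ((xs @ [v]) @ [a])" by (rule reorder.rotate_first)
    moreover have "reorder c (xs @ v # a # []) (xs @ a # v # [])"
      by (rule reorder.swap_commuting) (use rotate_first.prems False in auto)
    ultimately show ?thesis using reorder.then_reorder by fastforce
  next
    case True
    have "reorder c ([a] @ xs @ v # []) ([a] @ v # xs @ [])"
      by (rule reorder_move_front) (use rotate_first.prems True in auto)
    moreover have "reorder c ([a, v] @ xs) (xs @ [a, v])" by (rule reorder_rotate_append)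
    ultimately show ?thesis using reorder.then_reorder by fastforce
  qed
next
  case (then_reorder xs ys zs)
  have "set xs = set ys" "distinct ys" using reorder_set[OF then_reorder.hyps(1)] then_reorder.prems by auto
  then have "reorder c (xs @ [v]) (ys @ [v])" "reorder c (ys @ [v]) (zs @ [v])"
    using then_reorder by auto
  then show ?case by (rule reorder.then_reorder)
qed

lemma reflect_commute:
  assumes "inner a b = 0"
  shows "reflect a (reflect b v) = reflect b (reflect a v)"
  using assms
  by (simp add: reflect_def cartan_pairing_def inner_diff_left inner_commute[of b a] algebra_simps)

lemma linearly_conjugate_reorder:
  assumes "reorder (\<lambda>a b. inner (\<beta> a) (\<beta> b) = 0) xs ys"
  shows "linearly_conjugate (reflections \<beta> xs) (reflections \<beta> ys)"
  using assms
proof (induction rule: reorder.induct)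
  case (same xs)
  show ?case by (rule linearly_conjugate_refl)
next
  case (swap_commuting a b xs ys)
  have "reflections \<beta> (xs @ a # b # ys) = reflections \<beta> (xs @ b # a # ys)"
    by (rule ext) (simp add: reflect_commute[OF swap_commuting])
  then show ?case using linearly_conjugate_refl by metis
next
  case (rotate_first a xs)
  show ?case
    by (rule linearly_conjugateI[of "reflect (\<beta> a)" "reflect (\<beta> a)"]) (simp_all add: linear_reflect)
next
  case (then_reorder xs ys zs)
  then show ?case using linearly_conjugate_trans by blast
qed

context based_root_system
begin

text \<open>Induction on the forest: some vertex of \<open>S\<close> has at most one neighbour in \<open>S\<close>; it is rotated to the
  end of both words, and the rest is handled by the induction hypothesis.\<close>

lemma reorder_all:
  assumes "S \<subseteq> {1..n}" "distinct xs" "distinct ys" "set xs = S" "set ys = S"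
  shows "reorder (\<lambda>a b. inner (\<alpha> a) (\<alpha> b) = 0) xs ys"
  using assms
proof (induction "card S" arbitrary: S xs ys)
  case 0
  then have "S = {}" using finite_subset[of S "{1..n}"] by auto
  then show ?case using 0 by (simp add: reorder.same)
next
  case (Suc N)
  let ?c = "\<lambda>a b. inner (\<alpha> a) (\<alpha> b) = 0"
  have fin: "finite S" using Suc.prems(4) by auto
  have ne: "S \<noteq> {}" using Suc.hyps(2) by auto
  have "\<exists>v\<in>S. card (neighbours C S v) < 2"
  proof (rule ccontr)
    assume "\<not> ?thesis"
    then have "(\<Sum>v\<in>S. 2) \<le> valency_sum S"
      unfolding valency_sum_def by (intro sum_mono) (auto simp: not_less)
    then show False using forest[OF Suc.prems(1) ne] by simp
  qed
  then obtain v where v: "v \<in> S" "card (neighbours C S v) < 2" by blast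
  have fin_nb: "finite (neighbours C S v)" using fin unfolding neighbours_def by simp
  obtain m where m: "neighbours C S v \<subseteq> {m}"
  proof (cases "neighbours C S v = {}")
    case False
    then have "card (neighbours C S v) = 1"
      using v(2) fin_nb card_gt_0_iff[of "neighbours C S v"] by linarith
    then show ?thesis using that by (metis card_1_singletonE order_refl)
  qed (use that in auto)
  obtain as bs where xs: "xs = as @ v # bs" using v(1) Suc.prems(4) by (metis split_list)
  obtain cs ds where ys: "ys = cs @ v # ds" using v(1) Suc.prems(5) by (metis split_list)
  have S': "S - {v} \<subseteq> {1..n}" "N = card (S - {v})" using Suc.prems(1) Suc.hyps(2) v(1) fin by auto
  have IH: "reorder ?c (bs @ as) (ds @ cs)"
    by (rule Suc.hyps(1)[OF S'(2) S'(1)]) (use Suc.prems xs ys in auto)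
  have mid: "reorder ?c ((bs @ as) @ [v]) ((ds @ cs) @ [v])"
  proof (rule reorder_snoc[OF IH, of m])
    show "distinct (bs @ as)" using Suc.prems(2) xs by auto
    fix x assume x: "x \<in> set (bs @ as)" "x \<noteq> m"
    then have "x \<in> S" "x \<noteq> v" using Suc.prems(2,4) xs by auto
    moreover have "x \<notin> neighbours C S v" using m x(2) by blast
    ultimately have "C v x = 0" unfolding neighbours_def by blast
    then have "inner (\<alpha> v) (\<alpha> x) = 0"
      using cartan_eq_0_iff[of v x] \<open>x \<in> S\<close> v(1) Suc.prems(1) by blast
    then show "inner (\<alpha> x) (\<alpha> v) = 0 \<and> inner (\<alpha> v) (\<alpha> x) = 0" by (simp add: inner_commute)
  qed
  have first: "reorder ?c xs ((bs @ as) @ [v])"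
  proof (rule reorder.then_reorder)
    show "reorder ?c xs ((v # bs) @ as)" unfolding xs by (rule reorder_rotate_append)
    show "reorder ?c ((v # bs) @ as) ((bs @ as) @ [v])"
      using reorder.rotate_first[of ?c v "bs @ as"] by simp
  qed
  have last: "reorder ?c ((ds @ cs) @ [v]) ys"
    using reorder_rotate_append[of ?c ds "cs @ [v]"] unfolding ys by simp
  show ?case using reorder.then_reorder[OF first reorder.then_reorder[OF mid last]] .
qed

lemma coef_span_0:
  assumes "x \<in> span (\<alpha> ` S)" "S \<subseteq> {1..n}" "a \<in> {1..n}" "a \<notin> S"
  shows "coef a x = 0"
  by (rule linear_eq_0_on_span[OF linear_coef _ assms(1)]) (use assms coef_simple in auto)

text \<open>Applying the first reflection to both sides expresses a multiple of \<open>\<alpha> a\<close> by the remaining simple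
  roots, so it vanishes by independence.\<close>

lemma reflections_fixed_orthogonal:
  assumes "distinct js" "set js \<subseteq> {1..n}" "reflections \<alpha> js v = v" "j \<in> set js"
  shows "inner v (\<alpha> j) = 0"
  using assms
proof (induction js)
  case (Cons a js)
  have a: "a \<in> {1..n}" "a \<notin> set js" using Cons.prems by auto
  have w: "reflections \<alpha> js v = reflect (\<alpha> a) v"
    using Cons.prems(3) by (metis reflect_reflect reflections_Cons)
  have "coef a (reflections \<alpha> js v - v) = 0"
    by (rule coef_span_0[OF reflections_diff_in_span]) (use Cons.prems a in auto)
  then have cp: "cartan_pairing v (\<alpha> a) = 0"
    unfolding w using a by (simp add: coef_simps coef_reflect)
  then have "inner v (\<alpha> a) = 0" using simple_nonzero[OF a(1)] by (simp add: cartan_pairing_def)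
  moreover have "reflections \<alpha> js v = v" unfolding w by (simp add: reflect_def cp)
  ultimately show ?case using Cons by auto
qed simp

lemma reflections_no_fixed_vector:
  assumes "distinct js" "set js = {1..n}" "reflections \<alpha> js v = v"
  shows "v = 0"
proof -
  have "inner v (\<alpha> j) = 0" if "j \<in> {1..n}" for j
    by (rule reflections_fixed_orthogonal[of js]) (use assms that in auto)
  then have "inner v v = 0" by (subst inner_expansion) (simp add: inner_commute)
  then show ?thesis by simp
qed

text \<open>A simple reflection makes a positive root negative only if it is the reflection in that root.\<close>

lemma sign_change:
  assumes "positive r" "set js \<subseteq> {1..n}" "\<not> positive (reflections \<alpha> js r)"
  obtains xs i ys where "js = xs @ i # ys" "reflections \<alpha> ys r = \<alpha> i"
proof -
  have "\<exists>xs i ys. js = xs @ i # ys \<and> reflections \<alpha> ys r = \<alpha> i"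
    using assms(2,3)
  proof (induction js)
    case Nil
    then show ?case using assms(1) by simp
  next
    case (Cons a js)
    show ?case
    proof (cases "positive (reflections \<alpha> js r)")
      case True
      then have "reflections \<alpha> js r = \<alpha> a"
        using positive_reflect_simple[OF True, of a] Cons.prems by auto
      then show ?thesis by (intro exI[of _ "[]"] exI[of _ a] exI[of _ js]) simp
    next
      case False
      then obtain xs i ys where "js = xs @ i # ys" "reflections \<alpha> ys r = \<alpha> i"
        using Cons by auto
      then show ?thesis by (intro exI[of _ "a # xs"] exI[of _ i] exI[of _ ys]) simp
    qed
  qed
  then show ?thesis using that by blast
qed

lemma linear_funpow:
  fixes f :: "'b::real_vector \<Rightarrow> 'b"
  assumes "linear f"
  shows "linear (f ^^ m)"
proof (induction m)
  case 0
  show ?case by (simp add: id_def linear_ident)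
next
  case (Suc m)
  show ?case using linear_compose[OF Suc assms] by (simp add: o_def)
qed

lemma inner_reflections_funpow:
  "inner ((reflections \<alpha> js ^^ m) v) ((reflections \<alpha> js ^^ m) w) = inner v w"
  by (induction m) simp_all

end

section \<open>The orbit of the highest root under a Coxeter element\<close>

context highest_root_system
begin

text \<open>The orbit is finite, and its sum is fixed by the Coxeter element and hence zero; so it cannot
  consist of positive roots only.\<close>

lemma coxeter_orbit_leaves_positive:
  assumes n: "n \<ge> 1" and L: "distinct L" "set L = {1..n}"
  obtains m where "positive ((reflections \<alpha> L ^^ m) \<theta>)"
    "\<not> positive ((reflections \<alpha> L ^^ Suc m) \<theta>)"
proof -
  define c where "c = reflections \<alpha> L"
  define x where "x m = (c ^^ m) \<theta>" for m
  have lin: "linear c" unfolding c_def by (rule linear_reflections)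
  have "\<exists>m. positive (x m) \<and> \<not> positive (x (Suc m))"
  proof (rule ccontr)
    assume none: "\<not> ?thesis"
    have pos: "positive (x m)" for m
    proof (induction m)
      case 0
      show ?case using positive_theta[OF n] by (simp add: x_def)
    next
      case (Suc m)
      then show ?case using none by blast
    qed
    have "range x \<subseteq> R" using pos positive_root by blast
    then have "\<not> inj x" using finite_roots finite_subset finite_imageD infinite_UNIV_nat by blast
    then obtain a b where "a < b" "x a = x b"
      unfolding inj_def by (metis linorder_neqE_nat)
    define N where "N = b - a"
    have N: "0 < N" "b = a + N" unfolding N_def using \<open>a < b\<close> by auto
    have "inj c"
      unfolding c_def by (rule inj_on_inverseI[of _ "reflections \<alpha> (rev L)"]) simp
    then have "inj (c ^^ a)" by (rule inj_fn)
    moreover have "(c ^^ a) (x N) = (c ^^ a) \<theta>"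
      using \<open>x a = x b\<close> unfolding N(2) x_def by (simp add: funpow_add)
    ultimately have xN: "x N = x 0" unfolding x_def by (simp add: inj_eq)
    define s where "s = (\<Sum>m<N. x m)"
    have "c s = (\<Sum>m<N. x (Suc m))" unfolding s_def by (simp add: linear_sum[OF lin] x_def)
    also have "\<dots> = s"
    proof -
      have "x 0 + (\<Sum>m<N. x (Suc m)) = (\<Sum>m<Suc N. x m)"
        by (rule sum.lessThan_Suc_shift[symmetric])
      then show ?thesis using xN unfolding s_def by simp
    qed
    finally have "s = 0" unfolding c_def by (rule reflections_no_fixed_vector[OF L])
    have "1 \<in> {1..n}" using n by simp
    then have "0 \<le> coef 1 (x m)" for m using pos unfolding positive_def by blast
    then have "coef 1 (x 0) \<le> (\<Sum>m<N. coef 1 (x m))" using N(1) by (intro member_le_sum) auto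
    also have "\<dots> = coef 1 s" unfolding s_def by (simp add: coef_simps)
    finally have "coef 1 \<theta> \<le> 0" using \<open>s = 0\<close> by (simp add: x_def coef_simps)
    then show False using coef_theta_ge_1[OF \<open>1 \<in> {1..n}\<close>] by simp
  qed
  then show ?thesis using that unfolding x_def c_def by blast
qed

lemma coxeter_orbit_representative:
  assumes n: "n \<ge> 1" and L: "distinct L" "set L = {1..n}"
  obtains m xs i ys where "L = xs @ i # ys"
    "reflections \<alpha> ys ((reflections \<alpha> L ^^ m) \<theta>) = \<alpha> i"
    "inner (\<alpha> i) (\<alpha> i) = inner \<theta> \<theta>"
proof -
  obtain m where m: "positive ((reflections \<alpha> L ^^ m) \<theta>)"
    "\<not> positive (reflections \<alpha> L ((reflections \<alpha> L ^^ m) \<theta>))"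
    using coxeter_orbit_leaves_positive[OF n L] by auto
  then obtain xs i ys where *: "L = xs @ i # ys" "reflections \<alpha> ys ((reflections \<alpha> L ^^ m) \<theta>) = \<alpha> i"
    using sign_change[OF m(1) _ m(2)] L(2) by blast
  have "inner (\<alpha> i) (\<alpha> i) = inner \<theta> \<theta>"
    unfolding *(2)[symmetric] by (simp add: inner_reflections_funpow)
  with * show ?thesis using that by blast
qed

text \<open>Both \<open>\<theta>\<close> and \<open>\<alpha> i\<close> turn the invariant \<open>inner (c \<gamma>) \<gamma>\<close> into a local expression: the reflections
  other than that in \<open>\<alpha> j\<close> fix \<open>\<theta>\<close>, and \<open>c\<close> is conjugate to a product that starts with the
  reflection in \<open>\<alpha> i\<close>.\<close>

lemma weighted_valency_orbit:
  assumes L: "distinct L" "set L = {1..n}" "L = xs @ i # ys"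
    and orbit: "reflections \<alpha> ys ((reflections \<alpha> L ^^ m) \<theta>) = \<alpha> i"
    and j: "j \<in> {1..n}" "\<And>l. l \<in> {1..n} - {j} \<Longrightarrow> inner (\<alpha> l) \<theta> = 0"
  shows "weighted_valency i = 4 - cartan_pairing \<theta> (\<alpha> j) * cartan_pairing (\<alpha> j) \<theta>"
proof -
  let ?c = "reflections \<alpha> L"
  define \<gamma> where "\<gamma> = (?c ^^ m) \<theta>"
  have i: "i \<in> {1..n}" using L by auto
  have th: "0 < inner \<theta> \<theta>" by (rule root_norm[OF theta_root])
  have len: "inner (\<alpha> i) (\<alpha> i) = inner \<theta> \<theta>"
    unfolding orbit[symmetric] by (simp add: inner_reflections_funpow)
  have "inner (?c \<theta>) \<theta> = inner \<theta> \<theta> - cartan_pairing \<theta> (\<alpha> j) * inner (\<alpha> j) \<theta>"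
  proof -
    obtain us vs where uv: "L = us @ j # vs" using j(1) L(2) by (metis split_list)
    have fix_theta: "reflections \<alpha> zs \<theta> = \<theta>" if "set zs \<subseteq> {1..n} - {j}" for zs
    proof (rule reflections_fixes)
      fix l assume "l \<in> set zs"
      then have "l \<in> {1..n} - {j}" using that by blast
      then show "inner \<theta> (\<alpha> l) = 0" using j(2)[of l] by (simp add: inner_commute)
    qed
    have "set vs \<subseteq> {1..n} - {j}" "set (rev us) \<subseteq> {1..n} - {j}" using uv L by auto
    then have "inner (?c \<theta>) \<theta> = inner (reflect (\<alpha> j) \<theta>) \<theta>"
      unfolding uv by (simp add: fix_theta inner_reflections_left)
    then show ?thesis by (simp add: reflect_def inner_diff_left)
  qed
  moreover have "inner (?c \<gamma>) \<gamma> = inner (?c \<theta>) \<theta>"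
  proof -
    have "?c \<gamma> = (?c ^^ m) (?c \<theta>)" unfolding \<gamma>_def by (simp add: funpow_swap1)
    then show ?thesis unfolding \<gamma>_def by (simp add: inner_reflections_funpow)
  qed
  moreover have "inner (?c \<gamma>) \<gamma> = - (inner \<theta> \<theta> / 2 * (2 - weighted_valency i))"
  proof -
    have orb: "reflections \<alpha> ys \<gamma> = \<alpha> i" using orbit unfolding \<gamma>_def .
    have g: "\<gamma> = reflections \<alpha> (rev ys) (\<alpha> i)"
      using orb by (metis reflections_rev_cancel)
    have "?c \<gamma> = - reflections \<alpha> xs (\<alpha> i)"
      unfolding L(3) by (simp add: orb reflect_self linear_neg[OF linear_reflections])
    then have "inner (?c \<gamma>) \<gamma> = - inner (reflections \<alpha> (ys @ xs) (\<alpha> i)) (\<alpha> i)"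
      unfolding g by (simp add: inner_reflections_left)
    also have "inner (reflections \<alpha> (ys @ xs) (\<alpha> i)) (\<alpha> i)
        = inner \<theta> \<theta> / 2 * cartan_pairing (reflections \<alpha> (ys @ xs) (\<alpha> i)) (\<alpha> i)"
      using th unfolding cartan_pairing_def len by simp
    also have "cartan_pairing (reflections \<alpha> (ys @ xs) (\<alpha> i)) (\<alpha> i) = 2 - weighted_valency i"
      by (rule cartan_pairing_reflections_rest[OF i]) (use L in auto)
    finally show ?thesis .
  qed
  moreover have "inner (\<alpha> j) \<theta> = inner \<theta> \<theta> / 2 * cartan_pairing (\<alpha> j) \<theta>"
    using th by (simp add: cartan_pairing_def)
  ultimately have "inner \<theta> \<theta> - cartan_pairing \<theta> (\<alpha> j) * (inner \<theta> \<theta> / 2 * cartan_pairing (\<alpha> j) \<theta>)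
      = - (inner \<theta> \<theta> / 2 * (2 - weighted_valency i))"
    by metis
  moreover have "w = 4 - p * q" if "T - p * (T / 2 * q) = - (T / 2 * (2 - w))" "0 < T" for T p q w :: real
  proof -
    have "T * (w - 4 + p * q) = 0" using that(1) by (simp add: field_simps)
    then show ?thesis using that(2) by simp
  qed
  ultimately show ?thesis using th by blast
qed

end

section \<open>Branch vertices\<close>

context based_root_system
begin

lemma sum_cartan_eq_neighbours:
  "- (\<Sum>j\<in>{1..n} - {i}. C i j) = (\<Sum>j\<in>neighbours C {1..n} i. - C i j)"
proof -
  have "(\<Sum>j\<in>neighbours C {1..n} i. C i j) = (\<Sum>j\<in>{1..n} - {i}. C i j)"
    by (rule sum.mono_neutral_left) (auto simp: neighbours_def)
  then show ?thesis by (simp add: sum_negf)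
qed

lemma branch_value_upper:
  assumes simp_edges: "\<And>j. j \<in> {1..n} - {i} \<Longrightarrow> -1 \<le> C i j"
  shows "branch_value C {1..n} i \<le> (if valency i = 1 then 2 else real (valency i))"
proof -
  have "(\<Sum>j\<in>neighbours C {1..n} i. - C i j) \<le> (\<Sum>j\<in>neighbours C {1..n} i. 1)"
  proof (rule sum_mono)
    fix j assume "j \<in> neighbours C {1..n} i"
    then have "j \<in> {1..n} - {i}" unfolding neighbours_def by auto
    then show "- C i j \<le> 1" using simp_edges[of j] by simp
  qed
  then have "- (\<Sum>j\<in>{1..n} - {i}. C i j) \<le> real (valency i)"
    unfolding sum_cartan_eq_neighbours valency_def by simp
  then show ?thesis unfolding branch_value_def valency_def[symmetric] by auto
qed

lemma branch_value_lower:
  assumes i: "i \<in> {1..n}" and j: "j \<in> {1..n}" "j \<noteq> i" "C i j \<le> -2"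
  shows "3 \<le> branch_value C {1..n} i"
proof -
  let ?N = "neighbours C {1..n} i"
  have fin: "finite ?N" unfolding neighbours_def by simp
  have jN: "j \<in> ?N" using j unfolding neighbours_def by auto
  have "real (card (?N - {j})) \<le> (\<Sum>l\<in>?N - {j}. - C i l)"
  proof -
    have "(\<Sum>l\<in>?N - {j}. 1) \<le> (\<Sum>l\<in>?N - {j}. - C i l)"
    proof (rule sum_mono)
      fix l assume "l \<in> ?N - {j}"
      then have "l \<in> {1..n}" "i \<noteq> l" "C i l \<noteq> 0" unfolding neighbours_def by auto
      then show "1 \<le> - C i l" using cartan_le_minus_1[OF i] by force
    qed
    then show ?thesis by simp
  qed
  then have sum: "2 + real (card (?N - {j})) \<le> - (\<Sum>l\<in>{1..n} - {i}. C i l)"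
    unfolding sum_cartan_eq_neighbours using sum.remove[OF fin jN, of "\<lambda>l. - C i l"] j by simp
  have card: "card ?N = Suc (card (?N - {j}))" using fin jN by (metis card.remove)
  show ?thesis
  proof (cases "card ?N = 1")
    case True
    then show ?thesis unfolding branch_value_def using sum by simp
  next
    case False
    then have "1 \<le> card (?N - {j})" using card by simp
    then show ?thesis unfolding branch_value_def using sum False by simp
  qed
qed

lemma weighted_valency_eq_neighbours:
  assumes "i \<in> {1..n}"
  shows "weighted_valency i = (\<Sum>j\<in>neighbours C {1..n} i. weight i j)"
  unfolding weighted_valency_def
  by (rule sum.mono_neutral_right) (use weight_eq_0_iff[OF assms] in \<open>auto simp: neighbours_def\<close>)

lemma heavy_edge_exists:
  assumes i: "i \<in> {1..n}" and less: "real (valency i) < weighted_valency i"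
  obtains u where "u \<in> {1..n}" "u \<noteq> i" "2 \<le> weight i u"
proof -
  have "\<exists>u\<in>neighbours C {1..n} i. 1 < weight i u"
  proof (rule ccontr)
    assume "\<not> ?thesis"
    then have "(\<Sum>j\<in>neighbours C {1..n} i. weight i j) \<le> (\<Sum>j\<in>neighbours C {1..n} i. 1)"
      by (intro sum_mono) auto
    then show False using less unfolding weighted_valency_eq_neighbours[OF i] valency_def by simp
  qed
  then obtain u where u: "u \<in> {1..n}" "u \<noteq> i" "1 < weight i u" unfolding neighbours_def by auto
  then have "2 \<le> weight i u" using weight_cases[OF i u(1)] by auto
  with u that show ?thesis by blast
qed

end

context highest_root_system
begin

abbreviation long :: "nat \<Rightarrow> bool" where
  "long i \<equiv> inner (\<alpha> i) (\<alpha> i) = inner \<theta> \<theta>"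

lemma simple_neq:
  assumes "i \<in> {1..n}" "j \<in> {1..n}" "i \<noteq> j"
  shows "\<alpha> i \<noteq> \<alpha> j" "\<alpha> i \<noteq> - \<alpha> j"
  using simple_not_proportional[OF assms, of 1] simple_not_proportional[OF assms, of "-1"] by auto

lemma cartan_long_right:
  assumes "i \<in> {1..n}" "j \<in> {1..n}" "i \<noteq> j" "long j"
  shows "-1 \<le> C i j"
  using cartan_pairing_long_root[OF simple_root[OF assms(2)] assms(4) simple_root[OF assms(1)] simple_neq[OF assms(1-3)]]
  unfolding cartan_matrix_def by simp

lemma cartan_long_short:
  assumes l: "l \<in> {1..n}" "long l" and s: "s \<in> {1..n}" "\<not> long s" and adj: "C l s \<noteq> 0"
  shows "C l s \<le> -2" "2 \<le> weight l s"
proof -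
  have ne: "l \<noteq> s" using l s by auto
  have adj': "C s l \<noteq> 0" using adj cartan_0_sym[OF l(1) s(1)] by simp
  have sl: "C s l \<le> -1" by (rule cartan_le_minus_1) (use l s ne adj' in auto)
  have "inner (\<alpha> s) (\<alpha> s) < inner \<theta> \<theta>" using theta_longest[OF simple_root[OF s(1)]] s(2) by simp
  then have lt: "inner (\<alpha> s) (\<alpha> s) < inner (\<alpha> l) (\<alpha> l)" using l(2) by simp
  have ps: "0 < inner (\<alpha> s) (\<alpha> s)" "0 < inner (\<alpha> l) (\<alpha> l)" using simple_norm l s by auto
  have eq: "C l s * inner (\<alpha> s) (\<alpha> s) = C s l * inner (\<alpha> l) (\<alpha> l)"
    using ps by (simp add: cartan_matrix_def cartan_pairing_def inner_commute)
  have "C s l * inner (\<alpha> l) (\<alpha> l) \<le> - 1 * inner (\<alpha> l) (\<alpha> l)"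
    by (rule mult_right_mono[OF sl]) (use ps in simp)
  also have "\<dots> < - 1 * inner (\<alpha> s) (\<alpha> s)" using lt by simp
  finally have "C l s * inner (\<alpha> s) (\<alpha> s) < - 1 * inner (\<alpha> s) (\<alpha> s)" using eq by simp
  then have "C l s < -1" using ps mult_less_cancel_right_pos by blast
  moreover obtain z where z: "C l s = of_int z" using cartan_Ints[OF l(1) s(1)] by (metis Ints_cases)
  ultimately have "z < -1" by simp
  then have "of_int z \<le> (of_int (-2) :: real)" unfolding of_int_le_iff by simp
  then show ls: "C l s \<le> -2" unfolding z by simp
  have "2 * 1 \<le> - C l s * - C s l" by (rule mult_mono) (use ls sl in auto)
  then show "2 \<le> weight l s" unfolding weight_def by simp
qed

lemma long_long_weight:
  assumes "i \<in> {1..n}" "j \<in> {1..n}" "i \<noteq> j" "long i" "long j"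
  shows "weight i j \<le> 1"
proof -
  have "-1 \<le> C i j" "-1 \<le> C j i" "C i j \<le> 0" "C j i \<le> 0"
    using assms cartan_long_right cartan_nonpos by auto
  then have "- C i j * - C j i \<le> 1 * 1" by (intro mult_mono) auto
  then show ?thesis unfolding weight_def by simp
qed

lemma long_exists:
  assumes "n \<ge> 1"
  obtains i where "i \<in> {1..n}" "long i"
proof -
  have set: "set [1..<Suc n] = {1..n}" by (simp add: atLeastLessThanSuc_atLeastAtMost del: upt_Suc)
  obtain m xs i ys where L: "[1..<Suc n] = xs @ i # ys" and i: "long i"
    using coxeter_orbit_representative[OF assms distinct_upt set] by metis
  have "i \<in> set [1..<Suc n]" unfolding L by simp
  then show ?thesis using that i unfolding set by blast
qed

text \<open>If there are short simple roots, an edge joins a long one \<open>l\<close> to a short one, and \<open>l\<close> has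
  branch value at least three. A short branch vertex would have to reach this value by its
  valency or by a second multiple edge.\<close>

lemma branch_vertex_long:
  assumes k: "branch_vertex C {1..n} k"
  shows "long k"
proof (rule ccontr)
  assume short: "\<not> long k"
  have kX: "k \<in> {1..n}" and max: "\<And>j. j \<in> {1..n} \<Longrightarrow> branch_value C {1..n} j \<le> branch_value C {1..n} k"
    using k unfolding branch_vertex_def by auto
  have "n \<ge> 1" using kX by simp
  then obtain i where i: "i \<in> {1..n}" "long i" by (rule long_exists)
  let ?S = "{v \<in> {1..n}. long v}"
  obtain l s where l: "l \<in> ?S" and s: "s \<in> {1..n} - ?S" and ls: "C l s \<noteq> 0"
    using connected[of ?S] i kX short by blast
  have l': "l \<in> {1..n}" "long l" and s': "s \<in> {1..n}" "\<not> long s" and ne: "l \<noteq> s"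
    using l s by auto
  note heavy = cartan_long_short[OF l' s' ls]
  have "3 \<le> branch_value C {1..n} l"
    by (rule branch_value_lower[OF l'(1) s'(1) _ heavy(1)]) (use ne in simp)
  then have b3: "3 \<le> branch_value C {1..n} k" using max[OF l'(1)] by simp
  show False
  proof (cases "3 \<le> valency k")
    case True
    have "valency k \<le> card ({1..n} - {k})"
      unfolding valency_def by (rule card_mono) (auto simp: neighbours_def)
    then have "n \<ge> 3" using True kX by simp
    then show False using no_branching_with_heavy_edge[OF _ kX True l'(1) s'(1) ne heavy(2)] by blast
  next
    case False
    have "\<exists>u\<in>{1..n} - {k}. C k u < -1"
    proof (rule ccontr)
      assume "\<not> ?thesis"
      then have "branch_value C {1..n} k \<le> (if valency k = 1 then 2 else real (valency k))"
        by (intro branch_value_upper) (auto simp: not_less)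
      then show False using b3 False by (auto split: if_splits)
    qed
    then obtain u where u: "u \<in> {1..n}" "u \<noteq> k" "C k u < -1" by blast
    have "\<not> long u" using cartan_long_right[OF kX u(1)] u by auto
    then have "u \<noteq> l" "k \<noteq> l" using l' short by auto
    have "card {u, k, l} \<le> card {1..n}" by (rule card_mono) (use u kX l' in auto)
    then have n: "n \<ge> 3" using u \<open>u \<noteq> l\<close> \<open>k \<noteq> l\<close> by simp
    have "C u k \<noteq> 0" using u cartan_0_sym[OF kX u(1)] by auto
    then have "C u k \<le> -1" using cartan_le_minus_1[OF u(1) kX] u(2) by blast
    then have "1 * 1 < - C k u * - C u k" using u(3) by (intro mult_less_le_imp_less) auto
    then have "1 < weight k u" unfolding weight_def by simp
    then have "2 \<le> weight k u" using weight_cases[OF kX u(1)] u(2) by auto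
    then have "{k, u} = {l, s}"
      using heavy_edge_unique[OF n kX u(1) _ _ l'(1) s'(1) ne heavy(2)] u(2) by blast
    then show False using \<open>u \<noteq> l\<close> \<open>k \<noteq> l\<close> by auto
  qed
qed

text \<open>For a long \<open>\<alpha> i\<close> the entries \<open>C j i\<close> are \<open>0\<close> or \<open>-1\<close>, so that \<open>- C i j\<close> is the weight of the edge.\<close>

lemma branch_value_long:
  assumes i: "i \<in> {1..n}" "long i"
  shows "branch_value C {1..n} i = weighted_valency i + (if valency i = 1 then 1 else 0)"
proof -
  have "(\<Sum>j\<in>{1..n} - {i}. - C i j) = weighted_valency i"
    unfolding weighted_valency_def
  proof (rule sum.cong[OF refl])
    fix j assume j: "j \<in> {1..n} - {i}"
    show "- C i j = weight i j"
    proof (cases "C j i = 0")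
      case True
      then show ?thesis using cartan_0_sym[OF i(1), of j] j by (simp add: weight_def)
    next
      case False
      then have "C j i \<le> -1" using cartan_le_minus_1[of j i] i j by auto
      moreover have "-1 \<le> C j i" using cartan_long_right[of j i] i j by auto
      ultimately have "C j i = -1" by simp
      then show ?thesis by (simp add: weight_def)
    qed
  qed
  then show ?thesis unfolding branch_value_def valency_def[symmetric] by (simp add: sum_negf)
qed

text \<open>A weighted valency of three needs a vertex of valency three or a multiple edge, and there is at
  most one of these in the diagram. A multiple edge has only one long end.\<close>

lemma branch_vertex_unique:
  assumes i: "i \<in> {1..n}" "long i" "weighted_valency i = 3"
    and k: "branch_vertex C {1..n} k"
  shows "i = k"
proof (rule ccontr)
  assume ne: "i \<noteq> k"
  have kX: "k \<in> {1..n}" and max: "branch_value C {1..n} i \<le> branch_value C {1..n} k"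
    using k i(1) unfolding branch_vertex_def by auto
  have kl: "long k" by (rule branch_vertex_long[OF k])
  have "3 \<le> branch_value C {1..n} i" unfolding branch_value_long[OF i(1,2)] i(3) by simp
  then have wk: "3 \<le> weighted_valency k + (if valency k = 1 then 1 else 0)"
    using max unfolding branch_value_long[OF kX kl] by simp
  have n: "n \<ge> 3"
  proof (rule ccontr)
    assume "\<not> n \<ge> 3"
    then have "card {1..n} \<le> card {i, k}" using ne by simp
    then have "{i, k} = {1..n}" using i(1) kX by (intro card_seteq) auto
    then have "{1..n} - {i} = {k}" using ne by auto
    then have "weighted_valency i = weight i k" unfolding weighted_valency_def by simp
    then show False using i(3) long_long_weight[OF i(1) kX ne i(2) kl] by simp
  qed
  have i_heavy: "3 \<le> valency i \<or> (\<exists>u\<in>{1..n}. u \<noteq> i \<and> 2 \<le> weight i u)"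
  proof (cases "3 \<le> valency i")
    case False
    then have "real (valency i) < weighted_valency i" unfolding i(3) by simp
    then show ?thesis using heavy_edge_exists[OF i(1)] by metis
  qed simp
  have k_heavy: "3 \<le> valency k \<or> (\<exists>u\<in>{1..n}. u \<noteq> k \<and> 2 \<le> weight k u)"
  proof (cases "3 \<le> valency k")
    case False
    then have "real (valency k) < weighted_valency k" using wk by (auto split: if_splits)
    then show ?thesis using heavy_edge_exists[OF kX] by metis
  qed simp
  show False
  proof (cases "3 \<le> valency i \<and> 3 \<le> valency k")
    case True
    then show False using at_most_one_branching[OF n i(1) kX ne] by blast
  next
    case False
    then have "(\<exists>u\<in>{1..n}. u \<noteq> i \<and> 2 \<le> weight i u) \<or> (\<exists>u\<in>{1..n}. u \<noteq> k \<and> 2 \<le> weight k u)"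
      using i_heavy k_heavy by blast
    then obtain a b where ab: "a \<in> {1..n}" "b \<in> {1..n}" "a \<noteq> b" "2 \<le> weight a b"
      using i(1) kX by metis
    have "\<not> 3 \<le> valency i" "\<not> 3 \<le> valency k"
      using no_branching_with_heavy_edge[OF n _ _ ab] i(1) kX by blast+
    then obtain u v where u: "u \<in> {1..n}" "u \<noteq> i" "2 \<le> weight i u"
      and v: "v \<in> {1..n}" "v \<noteq> k" "2 \<le> weight k v"
      using i_heavy k_heavy by blast
    have "{i, u} = {k, v}" using heavy_edge_unique[OF n i(1) u(1) _ u(3) kX v(1) _ v(3)] u v by blast
    then have "u = k" using ne by (auto simp: doubleton_eq_iff)
    then show False using u(3) long_long_weight[OF i(1) kX ne i(2) kl] by simp
  qed
qed

section \<open>Growing the highest root from a long simple root\<close>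

text \<open>Starting from a long simple root, the reflections in the remaining simple roots can be
  applied in an order in which each new root is adjacent to an earlier one. Every reflection
  then adds its root, with multiplicity at least two if it is short.\<close>

lemma growing_product:
  assumes k: "k \<in> {1..n}" "long k"
  obtains js where "distinct js" "set js = {1..n} - {k}"
    "\<And>v. v \<in> {1..n} \<Longrightarrow> 1 \<le> coef v (reflections \<alpha> js (\<alpha> k))"
    "\<And>v. v \<in> {1..n} \<Longrightarrow> \<not> long v \<Longrightarrow> 2 \<le> coef v (reflections \<alpha> js (\<alpha> k))"
proof -
  define P where "P S \<longleftrightarrow> (\<exists>js. distinct js \<and> set js = S - {k} \<and>
    (\<forall>v\<in>S. 1 \<le> coef v (reflections \<alpha> js (\<alpha> k)) \<and>
      (\<not> long v \<longrightarrow> 2 \<le> coef v (reflections \<alpha> js (\<alpha> k)))) \<and>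
    (\<forall>v\<in>{1..n} - S. coef v (reflections \<alpha> js (\<alpha> k)) = 0))" for S
  have "P {1..n}"
  proof (rule connected_induct[OF k(1)])
    show "P {k}"
      unfolding P_def by (rule exI[of _ "[]"]) (use k in \<open>auto simp: coef_simple\<close>)
  next
    fix S u l
    assume kS: "k \<in> S" and S: "S \<subseteq> {1..n}" and PS: "P S" and u: "u \<in> S"
      and l: "l \<in> {1..n} - S" and ul: "C u l \<noteq> 0"
    obtain js where js: "distinct js" "set js = S - {k}"
      and one: "\<And>v. v \<in> S \<Longrightarrow> 1 \<le> coef v (reflections \<alpha> js (\<alpha> k))"
      and two: "\<And>v. v \<in> S \<Longrightarrow> \<not> long v \<Longrightarrow> 2 \<le> coef v (reflections \<alpha> js (\<alpha> k))"
      and zero: "\<And>v. v \<in> {1..n} - S \<Longrightarrow> coef v (reflections \<alpha> js (\<alpha> k)) = 0"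
      using PS unfolding P_def by blast
    define r where "r = reflections \<alpha> js (\<alpha> k)"
    have fin: "finite S" using S finite_subset by blast
    have lX: "l \<in> {1..n}" and lS: "l \<notin> S" using l by auto
    have r: "r \<in> R" unfolding r_def by (rule reflections_root) (use js S simple_root k in auto)
    have r_norm: "inner r r = inner \<theta> \<theta>" unfolding r_def using k(2) by simp
    define p where "p = cartan_pairing r (\<alpha> l)"
    have p: "p = (\<Sum>v\<in>S. coef v r * C v l)"
    proof -
      have "p = (\<Sum>v\<in>{1..n}. coef v r * C v l)"
        unfolding p_def by (subst cartan_pairing_expansion) (simp add: cartan_matrix_def)
      also have "\<dots> = (\<Sum>v\<in>S. coef v r * C v l)"
        by (rule sum.mono_neutral_right) (use S zero in \<open>auto simp: r_def\<close>)
      finally show ?thesis .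
    qed
    have terms: "coef v r * C v l \<le> 0" if "v \<in> S" for v
    proof (rule mult_nonneg_nonpos)
      have v: "v \<in> {1..n}" "v \<noteq> l" using that S lS by auto
      show "0 \<le> coef v r" using one[OF that] unfolding r_def by simp
      show "C v l \<le> 0" by (rule cartan_nonpos[OF v(1) lX v(2)])
    qed
    have "coef u r * C u l < 0"
    proof (rule mult_pos_neg)
      have "u \<in> {1..n}" "u \<noteq> l" using u S lS by auto
      then show "C u l < 0" using cartan_nonpos[of u l] lX ul by simp
      show "0 < coef u r" using one[OF u] unfolding r_def by simp
    qed
    moreover have "(\<Sum>v\<in>S - {u}. coef v r * C v l) \<le> 0" by (rule sum_nonpos) (use terms in auto)
    ultimately have p_neg: "p < 0" unfolding p by (subst sum.remove[OF fin u]) simp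
    obtain z where z: "p = of_int z"
      using cartan_pairing_Ints[OF simple_root[OF lX] r] unfolding p_def by (metis Ints_cases)
    have p1: "p \<le> -1" using p_neg unfolding z by simp
    \<comment> \<open>The pairings \<open>p\<close> and \<open>q\<close> of \<open>r\<close> and \<open>\<alpha> l\<close> in the two orders are in the ratio of the squared
      lengths, and \<open>q\<close> is a negative integer.\<close>
    have p2: "p \<le> -2" if short: "\<not> long l"
    proof -
      define q where "q = cartan_pairing (\<alpha> l) r"
      obtain y where y: "q = of_int y"
        using cartan_pairing_Ints[OF r simple_root[OF lX]] unfolding q_def by (metis Ints_cases)
      have pl: "0 < inner (\<alpha> l) (\<alpha> l)" "0 < inner r r" using simple_norm[OF lX] root_norm[OF r] by auto
      have eq: "p * inner (\<alpha> l) (\<alpha> l) = q * inner r r"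
        using pl by (simp add: p_def q_def cartan_pairing_def inner_commute)
      have lt: "inner (\<alpha> l) (\<alpha> l) < inner r r"
        using theta_longest[OF simple_root[OF lX]] short r_norm by simp
      have "p * inner (\<alpha> l) (\<alpha> l) < 0" using p_neg pl by (simp add: mult_neg_pos)
      then have "q < 0" using eq pl by (simp add: mult_less_0_iff)
      then have "q \<le> -1" unfolding y by simp
      then have "q * inner r r \<le> - 1 * inner r r" by (rule mult_right_mono) (use pl in simp)
      also have "\<dots> < - 1 * inner (\<alpha> l) (\<alpha> l)" using lt by simp
      finally have "p * inner (\<alpha> l) (\<alpha> l) < - 1 * inner (\<alpha> l) (\<alpha> l)" using eq by simp
      then have "p < -1" using pl mult_less_cancel_right_pos by blast
      then have "z < -1" unfolding z by simp
      then have "of_int z \<le> (of_int (-2) :: real)" unfolding of_int_le_iff by simp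
      then show ?thesis unfolding z by simp
    qed
    have new: "coef v (reflections \<alpha> (l # js) (\<alpha> k)) = (if v = l then - p else coef v r)"
      if "v \<in> {1..n}" for v
      using that lX zero[OF l] by (simp add: coef_reflect p_def r_def)
    show "P (insert l S)"
      unfolding P_def
    proof (intro exI[of _ "l # js"] conjI ballI impI)
      show "distinct (l # js)" using js lS by auto
      show "set (l # js) = insert l S - {k}" using js lS kS by auto
    next
      fix v assume v: "v \<in> insert l S"
      then have vX: "v \<in> {1..n}" using S lX by auto
      show "1 \<le> coef v (reflections \<alpha> (l # js) (\<alpha> k))"
        using new[OF vX] p1 one[of v] v unfolding r_def by auto
      show "2 \<le> coef v (reflections \<alpha> (l # js) (\<alpha> k))" if "\<not> long v"
        using new[OF vX] p2 two[of v] v that unfolding r_def by auto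
    next
      fix v assume "v \<in> {1..n} - insert l S"
      then show "coef v (reflections \<alpha> (l # js) (\<alpha> k)) = 0"
        using new[of v] zero[of v] unfolding r_def by auto
    qed
  qed
  then show ?thesis using that unfolding P_def by auto
qed

text \<open>The product is a root with full support, and by assumption its pairing with \<open>\<theta>\<close> is at least two:
  two simple roots contribute, or one with pairing two or with coefficient two. Since \<open>\<theta>\<close> is long,
  this only happens for \<open>\<theta>\<close> itself.\<close>

lemma highest_root_as_growing_product:
  assumes k: "k \<in> {1..n}" "long k"
    and not_single: "\<not> (\<exists>j\<in>{1..n}. (\<forall>l\<in>{1..n} - {j}. inner (\<alpha> l) \<theta> = 0) \<and> cartan_pairing \<theta> (\<alpha> j) = 1)"
  obtains js where "distinct js" "set js = {1..n} - {k}" "reflections \<alpha> js (\<alpha> k) = \<theta>"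
proof -
  obtain js where js: "distinct js" "set js = {1..n} - {k}"
    and one: "\<And>v. v \<in> {1..n} \<Longrightarrow> 1 \<le> coef v (reflections \<alpha> js (\<alpha> k))"
    and two: "\<And>v. v \<in> {1..n} \<Longrightarrow> \<not> long v \<Longrightarrow> 2 \<le> coef v (reflections \<alpha> js (\<alpha> k))"
    using growing_product[OF k] by blast
  define r where "r = reflections \<alpha> js (\<alpha> k)"
  have r: "r \<in> R" unfolding r_def by (rule reflections_root) (use js simple_root k in auto)
  have th: "0 < inner \<theta> \<theta>" by (rule root_norm[OF theta_root])
  define w where "w v = cartan_pairing (\<alpha> v) \<theta>" for v
  have w0: "0 \<le> w v" if "v \<in> {1..n}" for v
    using inner_theta_nonneg[OF that] th unfolding w_def cartan_pairing_def by simp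
  have w1: "1 \<le> w v" if v: "v \<in> {1..n}" and pos: "inner (\<alpha> v) \<theta> \<noteq> 0" for v
  proof -
    obtain z where z: "w v = of_int z"
      using cartan_pairing_Ints[OF theta_root simple_root[OF v]] unfolding w_def by (metis Ints_cases)
    have "w v \<noteq> 0" using pos th unfolding w_def cartan_pairing_def by simp
    with w0[OF v] show ?thesis unfolding z by simp
  qed
  have pair: "cartan_pairing r \<theta> = (\<Sum>v\<in>{1..n}. coef v r * w v)"
    unfolding w_def by (rule cartan_pairing_expansion)
  have term_ge: "w v \<le> coef v r * w v" if "v \<in> {1..n}" for v
    using mult_right_mono[OF one[OF that] w0[OF that]] unfolding r_def by simp
  have part: "(\<Sum>v\<in>T. coef v r * w v) \<le> cartan_pairing r \<theta>" if "T \<subseteq> {1..n}" for T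
    unfolding pair
  proof (rule sum_mono2[OF _ that])
    fix v assume "v \<in> {1..n} - T"
    then show "0 \<le> coef v r * w v" using term_ge[of v] w0[of v] by force
  qed simp
  have "2 \<le> cartan_pairing r \<theta>"
  proof -
    have "(\<Sum>v\<in>{1..n}. coef v \<theta> * inner (\<alpha> v) \<theta>) \<noteq> 0" using inner_expansion[of \<theta> \<theta>] th by simp
    then obtain j where j: "j \<in> {1..n}" "inner (\<alpha> j) \<theta> \<noteq> 0"
      by (metis (no_types, lifting) mult_eq_0_iff sum.not_neutral_contains_not_neutral)
    show ?thesis
    proof (cases "\<exists>l\<in>{1..n} - {j}. inner (\<alpha> l) \<theta> \<noteq> 0")
      case True
      then obtain l where l: "l \<in> {1..n}" "l \<noteq> j" "inner (\<alpha> l) \<theta> \<noteq> 0" by blast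
      have "1 \<le> coef j r * w j" "1 \<le> coef l r * w l"
        using term_ge[OF j(1)] w1[OF j] term_ge[OF l(1)] w1[OF l(1,3)] by linarith+
      then show ?thesis using part[of "{j, l}"] j(1) l(1,2) by simp
    next
      case False
      then have ne: "cartan_pairing \<theta> (\<alpha> j) \<noteq> 1" using not_single j(1) by blast
      have "2 \<le> coef j r * w j"
      proof (cases "long j")
        case True
        then have "w j = cartan_pairing \<theta> (\<alpha> j)"
          unfolding w_def cartan_pairing_def by (simp add: inner_commute)
        then have "w j \<noteq> 1" using ne by simp
        moreover obtain z where z: "w j = of_int z"
          using cartan_pairing_Ints[OF theta_root simple_root[OF j(1)]] unfolding w_def by (metis Ints_cases)
        ultimately have "z \<noteq> 1" "1 \<le> z" using w1[OF j] by auto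
        then have "2 \<le> w j" unfolding z by simp
        then show ?thesis using term_ge[OF j(1)] by linarith
      next
        case False
        have "2 * 1 \<le> coef j r * w j"
          using two[OF j(1) False] w1[OF j] unfolding r_def[symmetric] by (intro mult_mono) auto
        then show ?thesis by simp
      qed
      then show ?thesis using part[of "{j}"] j(1) by simp
    qed
  qed
  moreover have "r \<noteq> - \<theta>"
  proof
    assume "r = - \<theta>"
    then have "coef k r = - coef k \<theta>" by (simp add: coef_simps)
    then show False using one[OF k(1)] coef_theta_ge_1[OF k(1)] unfolding r_def by simp
  qed
  ultimately have "r = \<theta>" using cartan_pairing_long_root[OF theta_root refl r] by force
  then show ?thesis using that js unfolding r_def by blast
qed

section \<open>The affine Coxeter element\<close>

lemma reflections_affine:
  assumes "set js \<subseteq> {1..n}"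
  shows "reflections (\<alpha>(0 := - \<theta>)) js = reflections \<alpha> js"
  by (rule reflections_cong) (use assms in auto)

text \<open>If \<open>\<theta>\<close> is joined to a single simple root by a simple edge, \<open>0\<close> is placed last and the
  conjugation is a power of the Coxeter element. Otherwise \<open>0\<close> is placed first and \<open>k\<close> last, so
  that the two reflections cancel.\<close>

lemma affine_product_conjugate:
  assumes k: "branch_vertex C {1..n} k" and js: "distinct js" "set js = {1..n} - {k}"
  obtains L where "distinct L" "set L = {0..n}"
    "linearly_conjugate (reflections (\<alpha>(0 := - \<theta>)) L) (reflections \<alpha> js)"
proof -
  let ?\<beta> = "\<alpha>(0 := - \<theta>)"
  have kX: "k \<in> {1..n}" using k unfolding branch_vertex_def by blast
  have kl: "long k" by (rule branch_vertex_long[OF k])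
  have n1: "n \<ge> 1" using kX by simp
  have X0: "insert 0 {1..n} = {0..n}" using n1 by auto
  show ?thesis
  proof (cases "\<exists>j\<in>{1..n}. (\<forall>l\<in>{1..n} - {j}. inner (\<alpha> l) \<theta> = 0) \<and> cartan_pairing \<theta> (\<alpha> j) = 1")
    case True
    then obtain j where j: "j \<in> {1..n}" "\<And>l. l \<in> {1..n} - {j} \<Longrightarrow> inner (\<alpha> l) \<theta> = 0"
      "cartan_pairing \<theta> (\<alpha> j) = 1" by blast
    let ?L = "k # js"
    let ?c = "reflections \<alpha> ?L"
    have L: "distinct ?L" "set ?L = {1..n}" using js kX by (simp_all add: insert_absorb)
    obtain m xs i ys where split: "?L = xs @ i # ys"
      and orbit: "reflections \<alpha> ys ((?c ^^ m) \<theta>) = \<alpha> i" and il: "long i"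
      by (rule coxeter_orbit_representative[OF n1 L])
    have "i \<in> set ?L" unfolding split by simp
    then have iX: "i \<in> {1..n}" unfolding L(2) .
    have "cartan_pairing (\<alpha> j) \<theta> = 1"
    proof -
      have th: "0 < inner \<theta> \<theta>" by (rule root_norm[OF theta_root])
      have nj: "0 < inner (\<alpha> j) (\<alpha> j)" by (rule simple_norm[OF j(1)])
      have "2 * inner \<theta> (\<alpha> j) = inner (\<alpha> j) (\<alpha> j)" using j(3) nj by (simp add: cartan_pairing_def)
      then have eq: "cartan_pairing (\<alpha> j) \<theta> = inner (\<alpha> j) (\<alpha> j) / inner \<theta> \<theta>"
        by (simp add: cartan_pairing_def inner_commute)
      then have "0 < cartan_pairing (\<alpha> j) \<theta>" "cartan_pairing (\<alpha> j) \<theta> \<le> 1"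
        using th nj theta_longest[OF simple_root[OF j(1)]] by auto
      moreover obtain z where "cartan_pairing (\<alpha> j) \<theta> = of_int z"
        using cartan_pairing_Ints[OF theta_root simple_root[OF j(1)]] by (metis Ints_cases)
      ultimately show ?thesis by simp
    qed
    then have "weighted_valency i = 3"
      using weighted_valency_orbit[OF L split orbit j(1,2)] j(3) by simp
    then have ik: "i = k" by (rule branch_vertex_unique[OF iX il _ k])
    have "xs = []"
    proof (cases xs)
      case (Cons a xs')
      then have "a = k" "k \<in> set js" using split ik by auto
      then show ?thesis using L(1) by simp
    qed
    then have ys: "ys = js" using split by simp
    define \<gamma> where "\<gamma> = (?c ^^ m) \<theta>"
    have g: "reflections \<alpha> js \<gamma> = \<alpha> k" using orbit unfolding ys ik \<gamma>_def .
    have key: "?c (reflect \<gamma> v) = reflections \<alpha> js v" for v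
    proof -
      have "reflections \<alpha> js (reflect \<gamma> v) = reflect (\<alpha> k) (reflections \<alpha> js v)"
        using reflect_isometry[OF linear_reflections inner_reflections, of \<alpha> js \<gamma> v] g by simp
      then show ?thesis by simp
    qed
    show ?thesis
    proof (rule that[of "?L @ [0]"])
      have "0 \<notin> set ?L" unfolding L(2) by simp
      then show "distinct (?L @ [0])" using L(1) by simp
      have "set (?L @ [0]) = insert 0 (set ?L)" by auto
      then show "set (?L @ [0]) = {0..n}" unfolding L(2) X0 .
      have lin: "linear (?c ^^ m)" by (rule linear_funpow[OF linear_reflections])
      show "linearly_conjugate (reflections ?\<beta> (?L @ [0])) (reflections \<alpha> js)"
      proof (rule linearly_conjugateI[of "?c ^^ m" "reflections \<alpha> (rev ?L) ^^ m"])
        show "linear (?c ^^ m)" "linear (reflections \<alpha> (rev ?L) ^^ m)"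
          by (rule linear_funpow[OF linear_reflections])+
        have inverse: "(f ^^ m) ((h ^^ m) x) = x" if "\<And>x. f (h x) = x" for f h :: "'a \<Rightarrow> 'a" and x
          by (induction m arbitrary: x) (simp_all add: funpow_swap1 that)
        show "(reflections \<alpha> (rev ?L) ^^ m) ((?c ^^ m) x) = x" for x
          by (rule inverse) (rule reflections_rev_cancel)
        show "(?c ^^ m) ((reflections \<alpha> (rev ?L) ^^ m) x) = x" for x
          by (rule inverse) (rule reflections_cancel_rev)
        fix x
        have "reflections ?\<beta> (?L @ [0]) x = ?c (reflect \<theta> x)"
          using fun_cong[OF reflections_affine[of ?L], of "reflect \<theta> x"] L(2)
          by (simp only: reflections_append) (simp add: reflect_uminus)
        then have "(?c ^^ m) (reflections ?\<beta> (?L @ [0]) x) = ?c ((?c ^^ m) (reflect \<theta> x))"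
          by (simp add: funpow_swap1)
        also have "(?c ^^ m) (reflect \<theta> x) = reflect \<gamma> ((?c ^^ m) x)"
          unfolding \<gamma>_def
          by (rule reflect_isometry[OF lin inner_reflections_funpow, symmetric])
        finally show "(?c ^^ m) (reflections ?\<beta> (?L @ [0]) x) = reflections \<alpha> js ((?c ^^ m) x)"
          unfolding key .
      qed
    qed
  next
    case False
    obtain js' where js': "distinct js'" "set js' = {1..n} - {k}" "reflections \<alpha> js' (\<alpha> k) = \<theta>"
      using highest_root_as_growing_product[OF kX kl False] by blast
    have "reflections ?\<beta> (0 # js' @ [k]) x = reflections \<alpha> js' x" for x
    proof -
      have "reflections ?\<beta> (0 # js' @ [k]) x = reflect \<theta> (reflections \<alpha> js' (reflect (\<alpha> k) x))"
        using reflections_affine[of js'] js'(2) kX by (simp add: reflect_uminus)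
      also have "\<dots> = reflections \<alpha> js' (reflect (\<alpha> k) (reflect (\<alpha> k) x))"
        using reflect_isometry[OF linear_reflections inner_reflections, of \<alpha> js' "\<alpha> k"] js'(3) by simp
      finally show ?thesis by simp
    qed
    then have eq: "reflections ?\<beta> (0 # js' @ [k]) = reflections \<alpha> js'" by (rule ext)
    show ?thesis
    proof (rule that[of "0 # js' @ [k]"])
      have "k \<noteq> 0" "0 \<notin> set js'" "k \<notin> set js'" using kX unfolding js'(2) by auto
      then show "distinct (0 # js' @ [k])" using js'(1) by simp
      have "set (0 # js' @ [k]) = insert 0 (insert k (set js'))" by auto
      also have "\<dots> = {0..n}" using kX unfolding js'(2) X0[symmetric] by (simp add: insert_absorb)
      finally show "set (0 # js' @ [k]) = {0..n}" .
      show "linearly_conjugate (reflections ?\<beta> (0 # js' @ [k])) (reflections \<alpha> js)"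
        unfolding eq
        by (rule linearly_conjugate_reorder, rule reorder_all[OF _ js'(1) js(1) js'(2) js(2)]) auto
    qed
  qed
qed

end

theorem proposition6:
  fixes R :: "'a::euclidean_space set" and n :: nat and \<alpha> :: "nat \<Rightarrow> 'a" and \<theta> :: 'a
    and k :: nat and g :: "real poly"
  assumes "simple_root_system R"
    and "simple_roots R n \<alpha>"
    and "highest_root R n \<alpha> \<theta>"
    and "branch_vertex (cartan_matrix \<alpha>) {1..n} k"
    and "coxeter_polynomial (cartan_matrix \<alpha>) ({1..n} - {k}) g"
  shows "coxeter_polynomial (affine_cartan_matrix \<alpha> \<theta>) {0..n} ([:-1, 1:] ^ 2 * g)"
proof -
  interpret highest_root_system R n \<alpha> \<theta>
    using assms(1-3) by unfold_locales (auto simp: simple_root_system_def)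
  obtain js where js: "distinct js" "set js = {1..n} - {k}"
    and g: "g = char_poly (foldr (\<lambda>j M. sigma_mat (cartan_matrix \<alpha>) ({1..n} - {k}) j * M) js
      (1\<^sub>m (card ({1..n} - {k}))))"
    using assms(5) unfolding coxeter_polynomial_def by blast
  obtain L where L: "distinct L" "set L = {0..n}"
    "linearly_conjugate (reflections (\<alpha>(0 := - \<theta>)) L) (reflections \<alpha> js)"
    using affine_product_conjugate[OF assms(4) js] by blast
  have "k \<in> {1..n}" using assms(4) unfolding branch_vertex_def by blast
  then show ?thesis
    unfolding g
    by (rule coxeter_polynomial_affine_if_conjugate[OF inj_simple independent_simple span_simple _ js(2) L(2,1,3)])
qed

end
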